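(* Let $n\geq 3$ and let $\ell=(l_1,\ldots,l_n)\in\textup{int}(C_n)$. Then the directed system \[M_2(\ell)\xrightarrow{\varphi_2} M_3(\ell)\xrightarrow{\varphi_3} M_4(\ell)\xrightarrow{\varphi_4}\cdots \xrightarrow{\varphi_{d-1}} M_d(\ell) \xrightarrow{\varphi_d}\cdots\] of moduli spaces of $\ell$-gons stabilizes at $d=n$, that is, $M_d(\ell)$ is homeomorphic to $M_n(\ell)$ if and only if $d\geq n$.
   Context: For $n\geq 3$, $\ell=(l_1,\ldots,l_n)$ with all $l_i>0$, and $d\geq 2$, the polygon space is $V_d(\ell)=\{(\mathbf{v}_1,\ldots,\mathbf{v}_{n-1})\in(\mathbb{R}^d)^{n-1} : \|\mathbf{v}_i-\mathbf{v}_{i-1}\|=l_i,\ i=1,\ldots,n\}$, where $\mathbf{v}_0=\mathbf{v}_n=\mathbf{0}$; $SO(d)$ acts on it diagonally, and $M_d(\ell)=V_d(\ell)/SO(d)$ with quotient topology, $[P]$ denoting the class of $P$. $C_n$ is the set of $\ell\in\mathbb{R}^n$ with $l_i>0$ and $l_i\leq\sum_{j\neq i}l_j$ for all $i$; $\textup{int}(C_n)$ is its interior in $\mathbb{R}^n$ (i.e. all inequalities strict). Fix linear Euclidean isometries $f_d:\mathbb{R}^d\to\mathbb{R}^{d+1}$ for $d\geq 2$; let $F_d:V_d(\ell)\to V_{d+1}(\ell)$, $(\mathbf{v}_1,\ldots,\mathbf{v}_{n-1})\mapsto(f_d(\mathbf{v}_1),\ldots,f_d(\mathbf{v}_{n-1}))$,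 and $\varphi_d:M_d(\ell)\to M_{d+1}(\ell)$, $[P]\mapsto[F_d(P)]$. *)

theory Defs
  imports "HOL-Analysis.Analysis" "HOL-Combinatorics.Permutations"
begin

text \<open>Vectors of R^d are represented as functions nat => real vanishing outside {..<d};
  d x d matrices as functions nat => nat => real (only entries with indices < d matter).\<close>

definition Rvec :: "nat \<Rightarrow> (nat \<Rightarrow> real) set" where
  "Rvec d = {x. \<forall>k\<ge>d. x k = 0}"

definition vnorm :: "nat \<Rightarrow> (nat \<Rightarrow> real) \<Rightarrow> real" where
  "vnorm d x = sqrt (\<Sum>k<d. (x k)\<^sup>2)"

definition mdet :: "nat \<Rightarrow> (nat \<Rightarrow> nat \<Rightarrow> real) \<Rightarrow> real" where
  "mdet d A = (\<Sum>p | p permutes {..<d}. of_int (sign p) * (\<Prod>i<d. A i (p i)))"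

definition SOgrp :: "nat \<Rightarrow> (nat \<Rightarrow> nat \<Rightarrow> real) set" where
  "SOgrp d = {A. (\<forall>i<d. \<forall>j<d. (\<Sum>k<d. A k i * A k j) = (if i = j then 1 else 0))
                 \<and> mdet d A = 1}"

definition mact :: "nat \<Rightarrow> (nat \<Rightarrow> nat \<Rightarrow> real) \<Rightarrow> (nat \<Rightarrow> real) \<Rightarrow> (nat \<Rightarrow> real)" where
  "mact d A x = (\<lambda>i. if i < d then (\<Sum>j<d. A i j * x j) else 0)"

text \<open>Polygon space V_d(l): a polygon is P :: nat => (nat => real) with P i = v_i for
  1 <= i <= n-1 and P i = 0 for i = 0 and i >= n (so v_0 = v_n = 0). Side lengths l_1..l_n
  are given by l :: nat => real at indices 1..n.\<close>
definition polyV :: "nat \<Rightarrow> (nat \<Rightarrow> real) \<Rightarrow> nat \<Rightarrow> (nat \<Rightarrow> nat \<Rightarrow> real) set" where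
  "polyV n l d = {P. (\<forall>i. P i \<in> Rvec d) \<and> P 0 = (\<lambda>_. 0) \<and> (\<forall>i\<ge>n. P i = (\<lambda>_. 0))
                    \<and> (\<forall>i\<in>{1..n}. vnorm d (\<lambda>k. P i k - P (i - 1) k) = l i)}"

definition orbit_rel :: "nat \<Rightarrow> (nat \<Rightarrow> real) \<Rightarrow> nat \<Rightarrow> ((nat \<Rightarrow> nat \<Rightarrow> real) \<times> (nat \<Rightarrow> nat \<Rightarrow> real)) set" where
  "orbit_rel n l d = {(P, Q). P \<in> polyV n l d \<and> Q \<in> polyV n l d \<and>
                         (\<exists>A\<in>SOgrp d. Q = (\<lambda>i. mact d A (P i)))}"

definition quotient_topology :: "'a topology \<Rightarrow> ('a \<times> 'a) set \<Rightarrow> 'a set topology" where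
  "quotient_topology X R = topology (\<lambda>U. U \<subseteq> topspace X // R \<and> openin X (\<Union>U))"

text \<open>V_d(l) carries the subspace topology of (R^d)^(n-1) (the product topology on
  nat => nat => real restricted to this finite-dimensional set is the Euclidean one).\<close>
definition polyV_top :: "nat \<Rightarrow> (nat \<Rightarrow> real) \<Rightarrow> nat \<Rightarrow> (nat \<Rightarrow> nat \<Rightarrow> real) topology" where
  "polyV_top n l d = top_of_set (polyV n l d)"

definition polyM :: "nat \<Rightarrow> (nat \<Rightarrow> real) \<Rightarrow> nat \<Rightarrow> (nat \<Rightarrow> nat \<Rightarrow> real) set topology" where
  "polyM n l d = quotient_topology (polyV_top n l d) (orbit_rel n l d)"

definition intC :: "nat \<Rightarrow> (nat \<Rightarrow> real) set" where
  "intC n = {l. \<forall>i\<in>{1..n}. 0 < l i \<and> l i < (\<Sum>j\<in>{1..n} - {i}. l j)}"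

end

theory Submission
  imports Defs "HOL-Homology.Invariance_of_Domain" "Jordan_Normal_Form.Determinant"
begin

text \<open>Recording the squared diagonals embeds the Gram matrices of l-gons in R^D,
  D = n(n - 3)/2. Those coming from polygons in R^d with d >= n - 1 fill the compact convex set K of
  points with positive semidefinite Gram matrix, and K has interior because l lies in int C_n.
  For d >= n every polygon is fixed by a reflection, so its SO(d)-orbit is determined by the Gram
  matrix and M_d is homeomorphic to K. For d = n - 1 a nondegenerate Gram matrix
  has two orbits, so M_d is the double of K along its boundary; removing a point leaves a copy of
  R^D, which by invariance of domain cannot be mapped injectively onto K minus a point. For
  d < n - 1 the Gram matrix of a d-dimensional polygon is singular, and the Gram map is injective on a
  suitable open piece; an embedding of K would give an open subset of R^D inside the boundary of
  K.\<close>

section \<open>Orthogonal matrices and Gram matrices\<close>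

text \<open>By polarization every Gram entry is affine in the squared diagonals, which is why K is
  convex. Compactness of the polygon space bounds K, and boundedness makes the Minkowski functional
  of K about an interior point positive off the origin. This gauge supplies all the convex geometry:
  \<open>g < 1\<close> is the positive definite locus, and a point with \<open>g = 1\<close> leaves
  K when pushed outward. So a subset of K that is open in R^D consists of positive definite points;
  both negative results rest on this, and the dimension of M_d is never computed. The obstacle is
  orientation: equal Gram matrices yield an orthogonal matrix whose determinant may be -1. It is met
  by the sign of \<open>gdet\<close> against a fixed polygon, or by a reflection if there is a
  normal vector to all vertices. Strictness of the inequalities enters through a polygon with
  linearly independent vertices, built by repeatedly erecting a triangle into a new dimension. For n
  = 3 the space R^D is a point and K has no boundary; there the double is told from K by its two
  points.\<close>

definition ip :: "nat \<Rightarrow> (nat \<Rightarrow> real) \<Rightarrow> (nat \<Rightarrow> real) \<Rightarrow> real" where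
  "ip d x y = (\<Sum>k<d. x k * y k)"

definition mmul :: "nat \<Rightarrow> (nat \<Rightarrow> nat \<Rightarrow> real) \<Rightarrow> (nat \<Rightarrow> nat \<Rightarrow> real) \<Rightarrow> nat \<Rightarrow> nat \<Rightarrow> real" where
  "mmul d A B = (\<lambda>i j. \<Sum>k<d. A i k * B k j)"

definition Ogrp :: "nat \<Rightarrow> (nat \<Rightarrow> nat \<Rightarrow> real) set" where
  "Ogrp d = {A. \<forall>i<d. \<forall>j<d. (\<Sum>k<d. A k i * A k j) = (if i = j then 1 else 0)}"

lemma SOgrp_Ogrp: "SOgrp d = {A \<in> Ogrp d. mdet d A = 1}"
  by (auto simp: SOgrp_def Ogrp_def)

abbreviation jmat :: "nat \<Rightarrow> (nat \<Rightarrow> nat \<Rightarrow> real) \<Rightarrow> real mat" where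
  "jmat d A \<equiv> mat d d (\<lambda>(i, j). A i j)"

text \<open>The bridge to \<open>Jordan_Normal_Form\<close>, through which multiplicativity,
  transposition and the kernel criterion are inherited.\<close>

lemma mdet_det: "mdet d A = Determinant.det (jmat d A)"
proof -
  have "(\<Prod>i<d. A i (p i)) = (\<Prod>i = 0..<d. jmat d A $$ (i, p i))" if "p permutes {..<d}" for p
    using permutes_in_image[OF that] by (auto simp: lessThan_atLeast0 intro!: prod.cong)
  then show ?thesis
    unfolding mdet_def by (subst det_def'[where n = d]) (auto simp: lessThan_atLeast0 intro!: sum.cong)
qed

lemma mdet_cong: "(\<And>i j. i < d \<Longrightarrow> j < d \<Longrightarrow> A i j = B i j) \<Longrightarrow> mdet d A = mdet d B"
  unfolding mdet_det by (rule arg_cong[where f = Determinant.det]) auto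

lemma mdet_mmul: "mdet d (mmul d A B) = mdet d A * mdet d B"
proof -
  have "jmat d (mmul d A B) = jmat d A * jmat d B"
    by (rule eq_matI) (auto simp: mmul_def scalar_prod_def lessThan_atLeast0)
  then show ?thesis
    unfolding mdet_det by (simp add: Determinant.det_mult[where n = d])
qed

lemma mdet_transpose: "mdet d (\<lambda>i j. A j i) = mdet d A"
proof -
  have "jmat d (\<lambda>i j. A j i) = transpose_mat (jmat d A)"
    by (rule eq_matI) auto
  then show ?thesis
    unfolding mdet_det by (simp add: Determinant.det_transpose[where n = d])
qed

lemma mdet_diag: "mdet d (\<lambda>i j. if i = j then f i else 0) = (\<Prod>i<d. f i)"
  unfolding mdet_det
  by (subst det_upper_triangular[where n = d])
    (auto simp: prod_list_diag_prod lessThan_atLeast0)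

lemma mdet_eq_0_iff:
  "mdet d A = 0 \<longleftrightarrow> (\<exists>x\<in>Rvec d. x \<noteq> (\<lambda>_. 0) \<and> (\<forall>i<d. (\<Sum>j<d. A i j * x j) = 0))"
proof -
  have *: "jmat d A *\<^sub>v v = 0\<^sub>v d \<longleftrightarrow> (\<forall>i<d. (\<Sum>j<d. A i j * v $ j) = 0)" if "v \<in> carrier_vec d" for v
    using that by (auto simp: vec_eq_iff scalar_prod_def lessThan_atLeast0)
  have "mdet d A = 0 \<longleftrightarrow> (\<exists>v. v \<in> carrier_vec d \<and> v \<noteq> 0\<^sub>v d \<and> jmat d A *\<^sub>v v = 0\<^sub>v d)"
    unfolding mdet_det by (rule det_0_iff_vec_prod_zero_field) simp
  also have "\<dots> \<longleftrightarrow> (\<exists>x\<in>Rvec d. x \<noteq> (\<lambda>_. 0) \<and> (\<forall>i<d. (\<Sum>j<d. A i j * x j) = 0))"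
  proof safe
    fix v :: "real vec" assume v: "v \<in> carrier_vec d" "v \<noteq> 0\<^sub>v d" "jmat d A *\<^sub>v v = 0\<^sub>v d"
    let ?x = "\<lambda>i. if i < d then v $ i else 0"
    have "?x \<in> Rvec d" by (auto simp: Rvec_def)
    moreover have "?x \<noteq> (\<lambda>_. 0)"
    proof
      assume "?x = (\<lambda>_. 0)"
      then have "\<forall>i<d. v $ i = 0" by (metis (full_types))
      then show False using v by (auto simp: vec_eq_iff)
    qed
    moreover have "\<forall>i<d. (\<Sum>j<d. A i j * ?x j) = 0"
      using * v by auto
    ultimately show "\<exists>x\<in>Rvec d. x \<noteq> (\<lambda>_. 0) \<and> (\<forall>i<d. (\<Sum>j<d. A i j * x j) = 0)" by blast
  next
    fix x :: "nat \<Rightarrow> real" assume x: "x \<in> Rvec d" "x \<noteq> (\<lambda>_. 0)" "\<forall>i<d. (\<Sum>j<d. A i j * x j) = 0"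
    have "vec d x \<in> carrier_vec d" by simp
    moreover have "vec d x \<noteq> 0\<^sub>v d"
    proof
      assume "vec d x = 0\<^sub>v d"
      then have "\<forall>i<d. x i = 0" by (auto simp: vec_eq_iff)
      then show False using x by (auto simp: Rvec_def) (meson ext not_le)
    qed
    moreover have "jmat d A *\<^sub>v vec d x = 0\<^sub>v d"
      using * x by auto
    ultimately show "\<exists>v. v \<in> carrier_vec d \<and> v \<noteq> 0\<^sub>v d \<and> jmat d A *\<^sub>v v = 0\<^sub>v d" by blast
  qed
  finally show ?thesis .
qed

lemma underdetermined_kernel:
  assumes "m < d"
  shows "\<exists>x\<in>Rvec d. x \<noteq> (\<lambda>_. 0) \<and> (\<forall>i<m. (\<Sum>j<d. A i j * x j) = 0)"
proof -
  let ?B = "\<lambda>i j. if i < m then A i j else 0"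
  let ?z = "\<lambda>i. if i = m then 1 else 0 :: real"
  \<comment> \<open>\<open>?B\<close> pads the system with zero rows to a square one. Its row
    \<open>m\<close> is zero, so the unit vector \<open>?z\<close> lies in the kernel of the
    transpose.\<close>
  have "mdet d (\<lambda>i j. ?B j i) = 0"
    unfolding mdet_eq_0_iff
    by (rule bexI[of _ ?z]) (use assms in \<open>auto simp: Rvec_def fun_eq_iff if_distrib[of "\<lambda>x. _ * x"] cong: if_cong\<close>)
  then have "mdet d ?B = 0"
    using mdet_transpose[of d ?B] by simp
  then obtain x where x: "x \<in> Rvec d" "x \<noteq> (\<lambda>_. 0)" "\<forall>i<d. (\<Sum>j<d. ?B i j * x j) = 0"
    unfolding mdet_eq_0_iff by blast
  moreover have "(\<Sum>j<d. A i j * x j) = 0" if "i < m" for i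
    using x(3)[rule_format, of i] that assms by simp
  ultimately show ?thesis by blast
qed

section \<open>Inner products and the orthogonal group\<close>

lemma ip_commute: "ip d x y = ip d y x"
  by (simp add: ip_def mult.commute)

lemma ip_nonneg: "0 \<le> ip d x x"
  by (simp add: ip_def sum_nonneg)

lemma ip_eq_0_iff: "x \<in> Rvec d \<Longrightarrow> ip d x x = 0 \<longleftrightarrow> x = (\<lambda>_. 0)"
  by (auto simp: ip_def sum_nonneg_eq_0_iff Rvec_def fun_eq_iff) (metis lessThan_iff not_le)

lemma ip_pos: "x \<in> Rvec d \<Longrightarrow> x \<noteq> (\<lambda>_. 0) \<Longrightarrow> 0 < ip d x x"
  using ip_eq_0_iff[of x d] ip_nonneg[of d x] by linarith

lemma ip_diff: "ip d (\<lambda>k. x k - y k) (\<lambda>k. x k - y k) = ip d x x + ip d y y - 2 * ip d x y"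
  by (simp add: ip_def algebra_simps sum.distrib sum_subtractf sum_distrib_left)

lemma vnorm_ip: "vnorm d x = sqrt (ip d x x)"
  by (simp add: vnorm_def ip_def power2_eq_square)

lemma mact_Rvec: "mact d A x \<in> Rvec d"
  by (simp add: mact_def Rvec_def)

lemma mact_diff: "mact d A (\<lambda>k. x k - y k) = (\<lambda>k. mact d A x k - mact d A y k)"
  by (auto simp: mact_def fun_eq_iff algebra_simps sum_subtractf)

lemma mact_mmul: "mact d (mmul d A B) x = mact d A (mact d B x)"
proof
  fix i
  have "(\<Sum>j<d. (\<Sum>k<d. A i k * B k j) * x j) = (\<Sum>k<d. \<Sum>j<d. A i k * (B k j * x j))"
    by (subst sum.swap) (simp add: sum_distrib_right mult.assoc)
  then show "mact d (mmul d A B) x i = mact d A (mact d B x) i"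
    by (simp add: mact_def mmul_def sum_distrib_left)
qed

lemma ip_mact:
  assumes "A \<in> Ogrp d"
  shows "ip d (mact d A x) (mact d A y) = ip d x y"
proof -
  have "ip d (mact d A x) (mact d A y) = (\<Sum>k<d. \<Sum>i<d. \<Sum>j<d. x i * y j * (A k i * A k j))"
    unfolding ip_def mact_def by (intro sum.cong refl) (simp add: sum_product mult_ac)
  also have "\<dots> = (\<Sum>i<d. \<Sum>j<d. x i * y j * (\<Sum>k<d. A k i * A k j))"
    by (subst sum.swap, rule sum.cong[OF refl], subst sum.swap) (simp add: sum_distrib_left)
  also have "\<dots> = (\<Sum>i<d. \<Sum>j<d. if i = j then x i * y j else 0)"
    using assms by (intro sum.cong refl) (auto simp: Ogrp_def)
  finally show ?thesis
    by (simp add: ip_def)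
qed

lemma Ogrp_mmul:
  assumes "A \<in> Ogrp d" "B \<in> Ogrp d"
  shows "mmul d A B \<in> Ogrp d"
proof -
  have "(\<Sum>k<d. mmul d A B k i * mmul d A B k j) = (if i = j then 1 else 0)" if "i < d" "j < d" for i j
  proof -
    let ?c = "\<lambda>i k. B k i"
    have "(\<Sum>k<d. mmul d A B k i * mmul d A B k j) = ip d (mact d A (?c i)) (mact d A (?c j))"
      by (simp add: ip_def mact_def mmul_def)
    also have "\<dots> = ip d (?c i) (?c j)"
      by (rule ip_mact[OF assms(1)])
    also have "\<dots> = (if i = j then 1 else 0)"
      using assms(2) that by (simp add: Ogrp_def ip_def)
    finally show ?thesis .
  qed
  then show ?thesis by (simp add: Ogrp_def)
qed

lemma mdet_Ogrp:
  assumes "A \<in> Ogrp d"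
  shows "mdet d A = 1 \<or> mdet d A = -1"
proof -
  have "mdet d A * mdet d A = mdet d (mmul d (\<lambda>i j. A j i) A)"
    by (simp only: mdet_mmul mdet_transpose[of d A])
  also have "\<dots> = mdet d (\<lambda>i j. if i = j then 1 else 0)"
    using assms by (intro mdet_cong) (simp add: mmul_def Ogrp_def)
  also have "\<dots> = 1"
    by (simp add: mdet_diag)
  finally show ?thesis
    by (simp add: square_eq_1_iff)
qed

section \<open>Householder reflections, and orthogonal matrices carrying one tuple of vectors to
  another\<close>

definition reflection :: "nat \<Rightarrow> (nat \<Rightarrow> real) \<Rightarrow> nat \<Rightarrow> nat \<Rightarrow> real" where
  "reflection d u = (\<lambda>i j. (if i = j then 1 else 0) - 2 * u i * u j / ip d u u)"

lemma mact_reflection: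
  "mact d (reflection d u) x = (\<lambda>i. if i < d then x i - 2 * ip d u x / ip d u u * u i else 0)"
proof
  fix i
  have "(\<Sum>j<d. reflection d u i j * x j) =
      (\<Sum>j<d. (if i = j then x j else 0) - 2 * u i / ip d u u * (u j * x j))"
    by (rule sum.cong) (auto simp: reflection_def algebra_simps)
  also have "\<dots> = (if i < d then x i else 0) - 2 * u i / ip d u u * ip d u x"
    by (simp add: sum_subtractf ip_def sum_distrib_left)
  finally show "mact d (reflection d u) x i = (if i < d then x i - 2 * ip d u x / ip d u u * u i else 0)"
    by (simp add: mact_def)
qed

lemma reflection_Ogrp:
  assumes "ip d u u \<noteq> 0"
  shows "reflection d u \<in> Ogrp d"
proof -
  let ?s = "ip d u u"
  have "(\<Sum>k<d. reflection d u k i * reflection d u k j) = (if i = j then 1 else 0)" if "i < d" "j < d" for i j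
  proof -
    have "(\<Sum>k<d. reflection d u k i * reflection d u k j) =
      (\<Sum>k<d. (if k = i then if k = j then 1 else 0 else 0) - (if k = i then 2 * u i * u j / ?s else 0)
         - (if k = j then 2 * u i * u j / ?s else 0) + 4 * u i * u j / (?s * ?s) * (u k * u k))"
      by (rule sum.cong) (auto simp: reflection_def algebra_simps)
    also have "\<dots> = (if i = j then 1 else 0) - 4 * u i * u j / ?s + 4 * u i * u j / (?s * ?s) * ?s"
      using that by (simp add: sum.distrib sum_subtractf ip_def sum_distrib_left cong: if_cong)
    also have "\<dots> = (if i = j then 1 else 0)"
      using assms by (simp add: field_simps)
    finally show ?thesis .
  qed
  then show ?thesis by (simp add: Ogrp_def)
qed

text \<open>Induction on the number of vectors. If \<open>A\<close> already matches the first
  \<open>m\<close>, let \<open>r\<close> be the image of the next one and reflect in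
  \<open>u = r - y m\<close>. Equal lengths make this reflection send \<open>r\<close> to
  \<open>y m\<close>; equal inner products make \<open>u\<close> orthogonal to the earlier
  \<open>y i\<close>, which therefore stay put.\<close>

lemma Gram_eq_imp_Ogrp:
  fixes m :: nat
  assumes "\<And>i. i < m \<Longrightarrow> x i \<in> Rvec d" "\<And>i. i < m \<Longrightarrow> y i \<in> Rvec d"
    and "\<And>i j. i < m \<Longrightarrow> j < m \<Longrightarrow> ip d (x i) (x j) = ip d (y i) (y j)"
  shows "\<exists>A\<in>Ogrp d. \<forall>i<m. mact d A (x i) = y i"
  using assms
proof (induction m)
  case 0
  have "(\<lambda>i j. if i = j then 1 else 0) \<in> Ogrp d"
    by (auto simp: Ogrp_def if_distrib[of "\<lambda>x. x * _"] cong: if_cong)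
  then show ?case by auto
next
  case (Suc m)
  then obtain A where A: "A \<in> Ogrp d" "\<forall>i<m. mact d A (x i) = y i"
    by (metis less_SucI)
  define r where "r = mact d A (x m)"
  define u where "u = (\<lambda>k. r k - y m k)"
  have r: "r \<in> Rvec d" by (simp add: r_def mact_Rvec)
  have ym: "y m \<in> Rvec d" using Suc by simp
  have u: "u \<in> Rvec d" using r ym by (simp add: Rvec_def u_def)
  have rr: "ip d r r = ip d (y m) (y m)"
    using Suc.prems(3)[of m m] by (simp add: r_def ip_mact[OF A(1)])
  have ui: "ip d u (y i) = 0" if "i < m" for i
  proof -
    have "ip d r (y i) = ip d (y m) (y i)"
      using A that Suc.prems(3)[of m i] ip_mact[OF A(1), of "x m" "x i"] by (simp add: r_def)
    then show ?thesis by (simp add: u_def ip_def left_diff_distrib sum_subtractf)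
  qed
  show ?case
  proof (cases "u = (\<lambda>_. 0)")
    case True
    then have "r = y m" by (simp add: u_def fun_eq_iff)
    then show ?thesis using A by (auto simp: less_Suc_eq r_def)
  next
    case False
    then have s: "ip d u u > 0" using u ip_pos by blast
    have "2 * ip d u r = ip d u u"
      using rr by (simp add: u_def ip_diff) (simp add: ip_def algebra_simps sum_subtractf)
    then have "2 * ip d u r / ip d u u = 1" using s by simp
    then have "mact d (reflection d u) r = y m"
      using ym by (auto simp: mact_reflection u_def Rvec_def fun_eq_iff)
    moreover have "mact d (reflection d u) (y i) = y i" if "i < m" for i
      using ui[OF that] Suc.prems(2)[of i] that by (auto simp: mact_reflection Rvec_def fun_eq_iff)
    ultimately have "\<forall>i<Suc m. mact d (mmul d (reflection d u) A) (x i) = y i"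
      using A by (auto simp: mact_mmul less_Suc_eq r_def)
    moreover have "mmul d (reflection d u) A \<in> Ogrp d"
      using s A by (intro Ogrp_mmul reflection_Ogrp) auto
    ultimately show ?thesis by blast
  qed
qed

text \<open>A reflection is conjugate, by an orthogonal matrix moving the first basis vector to the
  normal direction, to the diagonal matrix with entries -1, 1, ..., 1.\<close>
lemma mdet_reflection:
  assumes u: "u \<in> Rvec d" "u \<noteq> (\<lambda>_. 0)"
  shows "mdet d (reflection d u) = -1"
proof -
  define s where "s = sqrt (ip d u u)"
  have s: "s > 0" "s * s = ip d u u" using ip_pos[OF u] by (auto simp: s_def)
  have d: "0 < d" using u by (cases d) (auto simp: Rvec_def)
  define v where "v = (\<lambda>k. u k / s)"
  have vv: "ip d v v = 1"
  proof -
    have "ip d v v = ip d u u / (s * s)"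
      by (simp add: ip_def v_def sum_divide_distrib)
    then show ?thesis using s ip_pos[OF u] by simp
  qed
  have vR: "v \<in> Rvec d" using u by (simp add: v_def Rvec_def)
  have refl: "reflection d u = reflection d v"
    unfolding reflection_def vv using s by (auto simp: v_def fun_eq_iff)
  define e where "e = (\<lambda>k :: nat. if k = 0 then 1 else 0 :: real)"
  have "e \<in> Rvec d" "ip d e e = 1"
    using d by (auto simp: e_def Rvec_def ip_def if_distrib[of "\<lambda>x. x * _"] cong: if_cong)
  then obtain A where A: "A \<in> Ogrp d" "mact d A e = v"
    using Gram_eq_imp_Ogrp[of 1 "\<lambda>_. e" d "\<lambda>_. v"] vR vv by auto
  have v: "v i = A i 0" if "i < d" for i
    using that d unfolding A(2)[symmetric] by (simp add: mact_def e_def if_distrib[of "\<lambda>x. _ * x"] cong: if_cong)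
  define R where "R = (\<lambda>i j :: nat. if i = j then if i = 0 then -1 else 1 else 0 :: real)"
  have "mdet d (mmul d (reflection d v) A) = mdet d (mmul d A R)"
  proof (rule mdet_cong)
    fix i j assume ij: "i < d" "j < d"
    have "mmul d (reflection d v) A i j = mact d (reflection d v) (\<lambda>k. A k j) i"
      using ij by (simp add: mmul_def mact_def)
    also have "\<dots> = A i j - 2 * (\<Sum>k<d. A k 0 * A k j) * A i 0"
      using ij v by (simp only: mact_reflection vv) (simp add: ip_def)
    also have "\<dots> = A i j * (if j = 0 then -1 else 1)"
      using A ij d by (simp add: Ogrp_def)
    also have "\<dots> = mmul d A R i j"
      using ij by (simp add: mmul_def R_def if_distrib[of "\<lambda>x. _ * x"] cong: if_cong)
    finally show "mmul d (reflection d v) A i j = mmul d A R i j" .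
  qed
  moreover have "mdet d R = -1"
    using d by (simp add: R_def mdet_diag prod.remove[of _ 0])
  moreover have "mdet d A \<noteq> 0" using mdet_Ogrp[OF A(1)] by auto
  ultimately have "mdet d (reflection d v) * mdet d A = - 1 * mdet d A"
    by (simp add: mdet_mmul)
  then show ?thesis
    using \<open>mdet d A \<noteq> 0\<close> unfolding refl by (simp only: mult_cancel_right) simp
qed

section \<open>Factoring positive semidefinite matrices\<close>

lemma nonneg_affine_imp_slope_zero:
  fixes a b :: real
  assumes "\<And>t. 0 \<le> 2 * t * b + a"
  shows "b = 0"
proof (rule ccontr)
  assume "b \<noteq> 0"
  then have "2 * (- (a + 1) / (2 * b)) * b = - (a + 1)" by simp
  with assms[of "- (a + 1) / (2 * b)"] show False by simp
qed

text \<open>Cholesky factorization by induction: \<open>r\<close> is the square root of the last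
  pivot, \<open>h\<close> the last column divided by \<open>r\<close>, and the induction hypothesis
  is applied to the Schur complement \<open>G'\<close>. A zero pivot forces its whole column to
  vanish, so \<open>h = 0\<close> is the right choice there.\<close>

lemma psd_imp_Gram:
  assumes "\<And>i j. i < m \<Longrightarrow> j < m \<Longrightarrow> G i j = G j i"
    and "\<And>z. 0 \<le> (\<Sum>i<m. \<Sum>j<m. z i * z j * G i j)"
  shows "\<exists>v. (\<forall>i<m. v i \<in> Rvec m) \<and> (\<forall>i<m. \<forall>j<m. ip m (v i) (v j) = G i j)"
  using assms
proof (induction m arbitrary: G)
  case 0
  then show ?case by auto
next
  case (Suc m)
  note sym = Suc.prems(1) and psd = Suc.prems(2)
  have split: "(\<Sum>i<Suc m. \<Sum>j<Suc m. z i * z j * G i j) =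
      (\<Sum>i<m. \<Sum>j<m. z i * z j * G i j) + 2 * z m * (\<Sum>i<m. z i * G i m) + z m * z m * G m m" for z
  proof -
    have "(\<Sum>j<m. z m * z j * G m j) = (\<Sum>j<m. z j * z m * G j m)"
      using sym by (intro sum.cong) auto
    then show ?thesis
      by (simp add: sum.distrib sum_distrib_left algebra_simps)
  qed
  define g where "g = G m m"
  define r where "r = sqrt g"
  define h where "h = (\<lambda>i. if g = 0 then 0 else G i m / r)"
  have g0: "0 \<le> g"
    using psd[of "\<lambda>i. if i = m then 1 else 0"] by (simp add: split g_def)
  have rr: "r * r = g" using g0 by (simp add: r_def)
  have col: "G i m = h i * r" if "i < m" for i
  proof (cases "g = 0")
    case True
    \<comment> \<open>With a zero pivot the form at the vector with entries 1 at \<open>i\<close>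
      and \<open>t\<close> at \<open>m\<close> is affine in \<open>t\<close>; being nonnegative for
      all \<open>t\<close>, it has slope zero.\<close>
    have "0 \<le> 2 * t * G i m + G i i" for t
    proof -
      let ?e = "\<lambda>k. if k = i then 1 else 0 :: real" and ?z = "\<lambda>k. if k = m then t else if k = i then 1 else 0"
      have "(\<Sum>k<m. \<Sum>j<m. ?z k * ?z j * G k j) = (\<Sum>k<m. \<Sum>j<m. ?e k * ?e j * G k j)"
        by (intro sum.cong refl) auto
      also have "\<dots> = G i i"
        using that by (simp add: if_distrib[of "\<lambda>x. _ * x"] if_distrib[of "\<lambda>x. x * _"] cong: if_cong)
      finally have 1: "(\<Sum>k<m. \<Sum>j<m. ?z k * ?z j * G k j) = G i i" .
      have "(\<Sum>k<m. ?z k * G k m) = (\<Sum>k<m. ?e k * G k m)"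
        by (intro sum.cong refl) auto
      also have "\<dots> = G i m"
        using that by (simp add: if_distrib[of "\<lambda>x. x * _"] cong: if_cong)
      finally have 2: "(\<Sum>k<m. ?z k * G k m) = G i m" .
      show ?thesis
        using psd[of ?z] True unfolding split 1 2 by (simp add: g_def)
    qed
    then have "G i m = 0" by (rule nonneg_affine_imp_slope_zero)
    then show ?thesis using True by (simp add: h_def)
  next
    case False
    then show ?thesis using g0 by (simp add: h_def r_def)
  qed
  define G' where "G' = (\<lambda>i j. G i j - h i * h j)"
  have "\<exists>v. (\<forall>i<m. v i \<in> Rvec m) \<and> (\<forall>i<m. \<forall>j<m. ip m (v i) (v j) = G' i j)"
  proof (rule Suc.IH)
    show "G' i j = G' j i" if "i < m" "j < m" for i j
      using sym that by (simp add: G'_def)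
    fix z :: "nat \<Rightarrow> real"
    define t where "t = (\<Sum>i<m. z i * h i)"
    \<comment> \<open>The last entry that minimizes the form of \<open>G\<close> when the others are
      \<open>z\<close>. At this value the form equals that of \<open>G'\<close> at \<open>z\<close>,
      so it inherits nonnegativity.\<close>
    define c where "c = (if g = 0 then 0 else - t / r)"
    have cr: "c * g + t * r = 0"
      by (cases "g = 0") (use rr in \<open>auto simp: c_def field_simps\<close>)
    have tt: "2 * c * (t * r) + c * c * g = - (t * t)"
    proof (cases "g = 0")
      case True
      then have "t = 0" by (simp add: t_def h_def)
      then show ?thesis using True by (simp add: c_def)
    next
      case False
      then have "r \<noteq> 0" using rr by auto
      then show ?thesis unfolding rr[symmetric] by (simp add: c_def False field_simps)
    qed
    have "(\<Sum>i<m. z i * G i m) = t * r"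
      unfolding t_def sum_distrib_right by (intro sum.cong refl) (simp add: col)
    then have "0 \<le> (\<Sum>i<m. \<Sum>j<m. z i * z j * G i j) + 2 * c * (t * r) + c * c * g"
      using psd[of "\<lambda>i. if i = m then c else z i"] unfolding split by (simp add: g_def)
    moreover have "(\<Sum>i<m. \<Sum>j<m. z i * z j * (h i * h j)) = t * t"
      by (simp add: t_def sum_product mult_ac)
    ultimately show "0 \<le> (\<Sum>i<m. \<Sum>j<m. z i * z j * G' i j)"
      using tt by (simp add: G'_def right_diff_distrib sum_subtractf)
  qed
  then obtain v where v: "\<And>i. i < m \<Longrightarrow> v i \<in> Rvec m"
      "\<And>i j. i < m \<Longrightarrow> j < m \<Longrightarrow> ip m (v i) (v j) = G' i j" by blast
  \<comment> \<open>Coordinate \<open>m\<close> is still free in each \<open>v i\<close>; the entry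
    \<open>h i\<close> there restores the product \<open>h i * h j\<close> subtracted in
    \<open>G'\<close>.\<close>
  define w where "w = (\<lambda>i. if i = m then (\<lambda>k. if k = m then r else 0) else (v i)(m := h i))"
  have w: "w i \<in> Rvec (Suc m)" if "i < Suc m" for i
    using that v(1)[of i] by (auto simp: w_def Rvec_def)
  have "ip (Suc m) (w i) (w j) = G i j" if ij: "i < Suc m" "j < Suc m" for i j
  proof -
    have restr: "ip m (\<lambda>k. if k = m then a else p k) (\<lambda>k. if k = m then b else q k) = ip m p q" for a b p q
      by (simp add: ip_def)
    have ips: "ip (Suc m) p q = ip m p q + p m * q m" for p q by (simp add: ip_def)
    consider "i < m" "j < m" | "i < m" "j = m" | "i = m" "j < m" | "i = m" "j = m"
      using ij by linarith
    then show ?thesis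
    proof cases
      case 1
      then show ?thesis using v(2)[of i j]
        by (simp add: ips w_def G'_def) (simp add: ip_def)
    next
      case 2
      then show ?thesis using col[of i] by (simp add: ips w_def) (simp add: ip_def)
    next
      case 3
      then show ?thesis using col[of j] sym[of m j] by (simp add: ips w_def) (simp add: ip_def)
    next
      case 4
      then show ?thesis using rr by (simp add: ips w_def g_def) (simp add: ip_def)
    qed
  qed
  with w show ?case by blast
qed

section \<open>Quotients, invariance of domain and gauges\<close>

text \<open>The defining predicate must first be shown to be a topology. Only intersections need the
  equivalence: distinct classes are disjoint, so the union of the common classes is the intersection
  of the two unions.\<close>

lemma openin_quotient_topology:
  assumes "equiv (topspace X) R"
  shows "openin (quotient_topology X R) U \<longleftrightarrow> U \<subseteq> topspace X // R \<and> openin X (\<Union>U)"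
proof -
  have Int: "\<Union>(S \<inter> T) = \<Union>S \<inter> \<Union>T" if "S \<subseteq> topspace X // R" "T \<subseteq> topspace X // R" for S T
    using that quotient_disj[OF assms] by blast
  have "istopology (\<lambda>U. U \<subseteq> topspace X // R \<and> openin X (\<Union>U))"
    unfolding istopology_def
  proof (intro conjI allI impI; (elim conjE)?)
    fix \<K> assume "\<forall>K\<in>\<K>. K \<subseteq> topspace X // R \<and> openin X (\<Union>K)"
    moreover have "\<Union>(\<Union>\<K>) = (\<Union>K\<in>\<K>. \<Union>K)" by blast
    ultimately show "openin X (\<Union>(\<Union>\<K>))" by (simp add: openin_clauses(3))
  qed (use Int in auto)
  then show ?thesis
    by (simp add: quotient_topology_def)
qed

lemma topspace_quotient_topology:
  assumes "equiv (topspace X) R"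
  shows "topspace (quotient_topology X R) = topspace X // R"
  using assms openin_quotient_topology[OF assms, of "topspace X // R"]
  by (metis Union_quotient openin_quotient_topology openin_subset openin_topspace subset_antisym order_refl)

lemma quotient_map_quotient_topology:
  assumes "equiv (topspace X) R"
  shows "quotient_map X (quotient_topology X R) (\<lambda>x. R `` {x})"
  unfolding quotient_map_def
proof (intro conjI allI impI)
  show "(\<lambda>x. R `` {x}) ` topspace X = topspace (quotient_topology X R)"
    by (auto simp: topspace_quotient_topology[OF assms] quotient_def)
  fix U assume U: "U \<subseteq> topspace (quotient_topology X R)"
  then have U': "U \<subseteq> topspace X // R"
    by (simp add: topspace_quotient_topology[OF assms])
  have "x \<in> \<Union>U \<longleftrightarrow> x \<in> topspace X \<and> R `` {x} \<in> U" for x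
  proof
    assume "x \<in> \<Union>U"
    then obtain C where C: "C \<in> U" "x \<in> C" by blast
    then have "C \<in> topspace X // R" using U' by blast
    then have "x \<in> topspace X" "R `` {x} = C"
      using C Union_quotient[OF assms] quotient_eq_iff[OF assms]
      by (blast, metis C(2) Image_singleton_iff assms equiv_class_eq quotientE)
    then show "x \<in> topspace X \<and> R `` {x} \<in> U" using C by simp
  next
    assume "x \<in> topspace X \<and> R `` {x} \<in> U"
    then show "x \<in> \<Union>U" using equiv_class_self[OF assms] by blast
  qed
  then have "{x \<in> topspace X. R `` {x} \<in> U} = \<Union>U" by blast
  then show "openin X {x \<in> topspace X. R `` {x} \<in> U} = openin (quotient_topology X R) U"
    using U' by (simp add: openin_quotient_topology[OF assms])
qed

text \<open>The universal property, applied in both directions, gives mutually inverse continuous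
  maps.\<close>

lemma quotient_maps_same_fibres_homeomorphic:
  assumes f: "quotient_map X Y f" and g: "quotient_map X Z g"
    and fg: "\<And>x y. x \<in> topspace X \<Longrightarrow> y \<in> topspace X \<Longrightarrow> f x = f y \<longleftrightarrow> g x = g y"
  obtains h where "homeomorphic_map Y Z h" "\<And>x. x \<in> topspace X \<Longrightarrow> h (f x) = g x"
proof -
  obtain h where h: "continuous_map Y Z h" "\<And>x. x \<in> topspace X \<Longrightarrow> h (f x) = g x"
    using quotient_map_lift_exists[OF f quotient_imp_continuous_map[OF g]] fg by metis
  obtain k where k: "continuous_map Z Y k" "\<And>x. x \<in> topspace X \<Longrightarrow> k (g x) = f x"
    using quotient_map_lift_exists[OF g quotient_imp_continuous_map[OF f]] fg by metis
  have "topspace Y = f ` topspace X" "topspace Z = g ` topspace X"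
    using f g by (simp_all add: quotient_map_def)
  then have "homeomorphic_maps Y Z h k"
    using h k by (auto simp: homeomorphic_maps_def)
  then have "homeomorphic_map Y Z h"
    using homeomorphic_maps_map by blast
  then show ?thesis using h that by blast
qed

text \<open>A continuous map from a compact space to a Hausdorff space is closed. This spares any
  explicit continuous section of the Gram map.\<close>

lemma compact_imp_quotient_map:
  fixes f :: "'a::topological_space \<Rightarrow> 'b::metric_space"
  assumes "compact S" "continuous_on S f"
  shows "quotient_map (top_of_set S) (top_of_set (f ` S)) f"
proof (rule continuous_closed_imp_quotient_map)
  show "continuous_map (top_of_set S) (top_of_set (f ` S)) f"
    using assms by simp
  show "closed_map (top_of_set S) (top_of_set (f ` S)) f"
  proof (rule continuous_imp_closed_map)
    show "compact_space (top_of_set S)"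
      using assms by (simp add: compact_space_subtopology compactin_euclidean_iff)
    show "Hausdorff_space (top_of_set (f ` S))"
      by (intro Hausdorff_space_subtopology Hausdorff_space_euclidean)
  qed (use assms in simp)
qed simp

section \<open>Euclidean spaces and boxes inside function spaces\<close>

lemma Euclidean_space_Rvec: "Euclidean_space D = top_of_set (Rvec D)"
  by (simp add: Euclidean_space_def Rvec_def euclidean_product_topology)

lemma invariance_of_domain_Rvec:
  assumes "openin (top_of_set (Rvec D)) U" "continuous_on U f" "f ` U \<subseteq> Rvec D" "inj_on f U"
  shows "openin (top_of_set (Rvec D)) (f ` U)"
proof -
  have "U \<subseteq> Rvec D" using assms(1) openin_imp_subset by blast
  then have "subtopology (Euclidean_space D) U = top_of_set U"
    by (simp add: Euclidean_space_Rvec subtopology_subtopology inf.absorb2)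
  then have "continuous_map (subtopology (Euclidean_space D) U) (Euclidean_space D) f"
    using assms by (auto simp: Euclidean_space_Rvec)
  then show ?thesis
    using invariance_of_domain_Euclidean_space[of D U f] assms by (simp add: Euclidean_space_Rvec)
qed

text \<open>Tychonoff. Used twice in succession it makes a box in
  \<open>nat \<Rightarrow> nat \<Rightarrow> real\<close> compact, although infinitely many
  coordinates are present.\<close>

lemma compact_fun_box:
  fixes S :: "'i \<Rightarrow> 'a::topological_space set"
  assumes "\<And>i. compact (S i)"
  shows "compact {f. \<forall>i. f i \<in> S i}"
proof -
  have "compactin (product_topology (\<lambda>_. euclidean) UNIV) (PiE UNIV S)"
    using assms by (simp add: compactin_PiE compactin_euclidean_iff)
  moreover have "PiE UNIV S = {f. \<forall>i. f i \<in> S i}" by auto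
  ultimately show ?thesis
    by (simp add: euclidean_product_topology compactin_euclidean_iff)
qed

lemma continuous_on_coord [continuous_intros]: "continuous_on S (\<lambda>x. x i)"
  by (rule continuous_on_subset[OF continuous_on_product_coordinates]) simp

lemma closed_Rvec: "closed (Rvec d)"
proof -
  have "Rvec d = (\<Inter>k\<in>{d..}. {x. x k = 0})" by (auto simp: Rvec_def)
  moreover have "closed {x :: nat \<Rightarrow> real. x k = 0}" for k
    by (intro closed_Collect_eq continuous_intros)
  ultimately show ?thesis by auto
qed

text \<open>Dividing by \<open>N z\<close> turns the inequalities into \<open>s y z \<le> 1\<close>,
  where \<open>s y z\<close> is linear in \<open>y\<close>. The maximum of \<open>s y z\<close> over
  the compact set \<open>S\<close> is then the Minkowski functional of the solution set. The last
  assumption says that no direction recedes to infinity, which gives positivity.\<close>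

lemma gauge_exists:
  fixes N :: "'z::topological_space \<Rightarrow> real" and L :: "nat \<Rightarrow> 'z \<Rightarrow> real"
  assumes S: "compact S" "S \<noteq> {}"
    and contN: "continuous_on S N" and contL: "\<And>k. continuous_on S (L k)"
    and pos: "\<And>z. z \<in> S \<Longrightarrow> 0 < N z"
    and neg: "\<And>y. y \<in> Rvec D \<Longrightarrow> y \<noteq> (\<lambda>_. 0) \<Longrightarrow> \<exists>z\<in>S. (\<Sum>k<D. y k * L k z) < 0"
  obtains g :: "(nat \<Rightarrow> real) \<Rightarrow> real" where "continuous_on UNIV g"
    "\<And>t y. 0 \<le> t \<Longrightarrow> g (\<lambda>k. t * y k) = t * g y"
    "\<And>y. y \<in> Rvec D \<Longrightarrow> y \<noteq> (\<lambda>_. 0) \<Longrightarrow> 0 < g y"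
    "\<And>y. g y \<le> 1 \<longleftrightarrow> (\<forall>z\<in>S. 0 \<le> N z + (\<Sum>k<D. y k * L k z))"
    "\<And>y. g y < 1 \<longleftrightarrow> (\<forall>z\<in>S. 0 < N z + (\<Sum>k<D. y k * L k z))"
proof -
  define T where "T = (\<lambda>k z. - L k z / N z)"
  have contT: "continuous_on S (T k)" for k
    unfolding T_def using pos by (intro continuous_intros contN contL) force
  define s where "s = (\<lambda>y z. \<Sum>k<D. y k * T k z)"
  have s: "s y z = - (\<Sum>k<D. y k * L k z) / N z" for y z
    by (simp add: s_def T_def sum_divide_distrib sum_negf)
  have "continuous_on S (s y)" for y
    unfolding s_def by (intro continuous_intros contT)
  then have "\<exists>w\<in>S. \<forall>z\<in>S. s y z \<le> s y w" for y
    using continuous_attains_sup[OF S] by blast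
  then obtain w where w: "\<And>y. w y \<in> S" "\<And>y z. z \<in> S \<Longrightarrow> s y z \<le> s y (w y)"
    by metis
  define g where "g = (\<lambda>y. s y (w y))"
  have "\<exists>C. \<forall>z\<in>S. \<bar>T k z\<bar> \<le> C" for k
    using continuous_attains_sup[OF S, of "\<lambda>z. \<bar>T k z\<bar>"] contT by (force intro: continuous_intros)
  then obtain C where C: "\<And>k z. z \<in> S \<Longrightarrow> \<bar>T k z\<bar> \<le> C k" by metis
  \<comment> \<open>A weighted l1 Lipschitz bound. It involves only the first \<open>D\<close>
    coordinates, so it yields continuity even in the product topology.\<close>
  have le: "g y - g x \<le> (\<Sum>k<D. \<bar>y k - x k\<bar> * C k)" for x y
  proof -
    have "g y - g x \<le> s y (w y) - s x (w y)"
      using w(2)[OF w(1)] by (simp add: g_def)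
    also have "\<dots> = (\<Sum>k<D. (y k - x k) * T k (w y))"
      by (simp add: s_def algebra_simps sum_subtractf)
    also have "\<dots> \<le> (\<Sum>k<D. \<bar>y k - x k\<bar> * C k)"
    proof (rule sum_mono)
      fix k
      have "(y k - x k) * T k (w y) \<le> \<bar>y k - x k\<bar> * \<bar>T k (w y)\<bar>"
        by (simp flip: abs_mult)
      also have "\<dots> \<le> \<bar>y k - x k\<bar> * C k"
        by (intro mult_left_mono C w(1)) simp
      finally show "(y k - x k) * T k (w y) \<le> \<bar>y k - x k\<bar> * C k" .
    qed
    finally show ?thesis .
  qed
  have "continuous_on UNIV g"
    unfolding continuous_on_def
  proof
    fix x :: "nat \<Rightarrow> real"
    have "continuous_on UNIV (\<lambda>y :: nat \<Rightarrow> real. \<Sum>k<D. \<bar>y k - x k\<bar> * C k)"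
      by (intro continuous_intros)
    then have "((\<lambda>y. \<Sum>k<D. \<bar>y k - x k\<bar> * C k) \<longlongrightarrow> (\<Sum>k<D. \<bar>x k - x k\<bar> * C k)) (at x)"
      unfolding continuous_on_def by blast
    then have lim: "((\<lambda>y. \<Sum>k<D. \<bar>y k - x k\<bar> * C k) \<longlongrightarrow> 0) (at x)"
      by simp
    have "norm (g y - g x) \<le> (\<Sum>k<D. \<bar>y k - x k\<bar> * C k)" for y
      using le[of y x] le[of x y] by (simp add: abs_minus_commute)
    then have "((\<lambda>y. g y - g x) \<longlongrightarrow> 0) (at x)"
      by (intro Lim_null_comparison[OF _ lim] always_eventually allI)
    then show "(g \<longlongrightarrow> g x) (at x)"
      by (simp add: LIM_zero_iff)
  qed
  moreover have "g (\<lambda>k. t * y k) = t * g y" if "0 \<le> t" for t y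
  proof -
    have st: "s (\<lambda>k. t * y k) z = t * s y z" for z
      by (simp add: s_def sum_distrib_left mult.assoc)
    show ?thesis
    proof (rule antisym)
      show "g (\<lambda>k. t * y k) \<le> t * g y"
        unfolding g_def st using w that by (intro mult_left_mono) auto
      show "t * g y \<le> g (\<lambda>k. t * y k)"
        using w(2)[of "w y" "\<lambda>k. t * y k"] w(1) by (simp add: g_def st)
    qed
  qed
  moreover have "0 < g y" if y: "y \<in> Rvec D" "y \<noteq> (\<lambda>_. 0)" for y
  proof -
    obtain z where z: "z \<in> S" "(\<Sum>k<D. y k * L k z) < 0" using neg[OF y] by blast
    then have "0 < s y z" using pos[OF z(1)] by (simp add: s divide_neg_pos)
    then show ?thesis using w(2)[OF z(1), of y] by (simp add: g_def)
  qed
  moreover have "g y \<le> 1 \<longleftrightarrow> (\<forall>z\<in>S. 0 \<le> N z + (\<Sum>k<D. y k * L k z))" for y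
  proof -
    have "g y \<le> 1 \<longleftrightarrow> (\<forall>z\<in>S. s y z \<le> 1)" unfolding g_def by (meson w order_trans)
    also have "\<dots> \<longleftrightarrow> (\<forall>z\<in>S. 0 \<le> N z + (\<Sum>k<D. y k * L k z))"
      by (rule ball_cong[OF refl]) (drule pos, simp add: s field_simps, linarith?)
    finally show ?thesis .
  qed
  moreover have "g y < 1 \<longleftrightarrow> (\<forall>z\<in>S. 0 < N z + (\<Sum>k<D. y k * L k z))" for y
  proof -
    have "g y < 1 \<longleftrightarrow> (\<forall>z\<in>S. s y z < 1)" unfolding g_def by (meson w le_less_trans)
    also have "\<dots> \<longleftrightarrow> (\<forall>z\<in>S. 0 < N z + (\<Sum>k<D. y k * L k z))"
      by (rule ball_cong[OF refl]) (drule pos, simp add: s field_simps, linarith?)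
    finally show ?thesis .
  qed
  ultimately show ?thesis using that by blast
qed

section \<open>Generic polygons\<close>

definition sq :: "nat \<Rightarrow> (nat \<Rightarrow> real) \<Rightarrow> (nat \<Rightarrow> real) \<Rightarrow> real" where
  "sq d x y = ip d (\<lambda>k. x k - y k) (\<lambda>k. x k - y k)"

lemma sq_commute: "sq d x y = sq d y x"
  unfolding sq_def ip_diff by (simp add: ip_commute)

lemma sq_self: "sq d x x = 0"
  by (simp add: sq_def ip_def)

lemma sq_zero: "sq d x (\<lambda>_. 0) = ip d x x"
  by (simp add: sq_def)

lemma ip_Rvec_eq:
  assumes "x \<in> Rvec m" "m \<le> d"
  shows "ip d x y = ip m x y"
proof -
  have "ip d x y = (\<Sum>k\<in>{..<m}. x k * y k)"
    unfolding ip_def using assms by (intro sum.mono_neutral_right) (auto simp: Rvec_def)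
  then show ?thesis by (simp add: ip_def)
qed

lemma Rvec_mono: "m \<le> d \<Longrightarrow> Rvec m \<subseteq> Rvec d"
  by (auto simp: Rvec_def)

lemma intC_iff: "l \<in> intC n \<longleftrightarrow> (\<forall>i\<in>{1..n}. 0 < l i \<and> 2 * l i < sum l {1..n})"
proof -
  have "(\<Sum>j\<in>{1..n} - {i}. l j) = sum l {1..n} - l i" if "i \<in> {1..n}" for i
    using that by (simp add: sum_diff1)
  then show ?thesis
    unfolding intC_def by (fastforce simp del: atLeastAtMost_iff)
qed

lemma polyV_iff:
  assumes "\<forall>i\<in>{1..n}. 0 < l i"
  shows "P \<in> polyV n l d \<longleftrightarrow> (\<forall>i. P i \<in> Rvec d) \<and> P 0 = (\<lambda>_. 0) \<and> (\<forall>i\<ge>n. P i = (\<lambda>_. 0)) \<and>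
    (\<forall>i\<in>{1..n}. sq d (P i) (P (i - 1)) = (l i)\<^sup>2)"
proof -
  have "vnorm d (\<lambda>k. P i k - P (i - 1) k) = l i \<longleftrightarrow> sq d (P i) (P (i - 1)) = (l i)\<^sup>2" if "i \<in> {1..n}" for i
  proof -
    have "sqrt s = a \<longleftrightarrow> s = a\<^sup>2" if "0 \<le> s" "0 < a" for s a :: real
      using that by auto
    then show ?thesis
      unfolding vnorm_ip sq_def using assms that ip_nonneg by blast
  qed
  then show ?thesis by (auto simp: polyV_def)
qed

text \<open>The second clause is linear independence of the vertices other than the origin: together
  with the origin they span a simplex of full dimension.\<close>

definition generic_polygon :: "nat \<Rightarrow> (nat \<Rightarrow> real) \<Rightarrow> (nat \<Rightarrow> nat \<Rightarrow> real) \<Rightarrow> bool" where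
  "generic_polygon n l P \<longleftrightarrow> P \<in> polyV n l (n - 1) \<and>
    (\<forall>z. (\<forall>k. (\<Sum>i\<in>{1..<n}. z i * P i k) = 0) \<longrightarrow> (\<forall>i\<in>{1..<n}. z i = 0))"

text \<open>The closing side \<open>x\<close> of an \<open>n\<close>-gon is replaced by the two
  other sides of a triangle erected over it. Its apex \<open>v\<close> is lifted into the new
  coordinate \<open>n - 1\<close>, where all old vertices vanish; a nonzero height \<beta> therefore
  keeps the vertices independent.\<close>

lemma generic_polygon_Suc:
  assumes n: "2 \<le> n" and l: "\<And>i. i \<in> {1..Suc n} \<Longrightarrow> 0 < l i"
    and x: "\<bar>l n - l (Suc n)\<bar> < x" "x < l n + l (Suc n)"
    and P: "generic_polygon n (l(n := x)) P"
  shows "\<exists>Q. generic_polygon (Suc n) l Q"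
proof -
  define a b where "a = l n" and "b = l (Suc n)"
  have ab: "0 < a" "0 < b" "0 < x" "\<bar>a - b\<bar> < x" "x < a + b"
    using l[of n] l[of "Suc n"] n x by (auto simp: a_def b_def)
  define p where "p = P (n - 1)"
  have lpos: "\<forall>i\<in>{1..n}. 0 < (l(n := x)) i"
    using l ab by auto
  have PV: "P \<in> polyV n (l(n := x)) (n - 1)" using P by (simp add: generic_polygon_def)
  have PR: "P i \<in> Rvec (n - 1)" "P 0 = (\<lambda>_. 0)" "n \<le> i \<Longrightarrow> P i = (\<lambda>_. 0)" for i
    using PV by (simp_all add: polyV_def)
  have Psq: "sq (n - 1) (P i) (P (i - 1)) = ((l(n := x)) i)\<^sup>2" if "i \<in> {1..n}" for i
    using PV that unfolding polyV_iff[where l = "l(n := x)", OF lpos] by blast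
  have pp: "ip n p p = x\<^sup>2"
  proof -
    have "sq (n - 1) (P (n - 1)) (P n) = x\<^sup>2"
      using Psq[of n] n by (simp add: sq_commute)
    then have "ip (n - 1) p p = x\<^sup>2" using PR(3)[of n] by (simp add: sq_zero p_def)
    then show ?thesis using PR(1)[of "n - 1"] by (subst ip_Rvec_eq[of _ "n - 1"]) (auto simp: p_def)
  qed
  \<comment> \<open>Law of cosines: \<alpha> is the position, along \<open>p\<close>, of the foot of
    the altitude from the apex at distance \<open>b\<close> from 0 and \<open>a\<close> from
    \<open>p\<close>.\<close>
  define \<alpha> where "\<alpha> = (1 + (b\<^sup>2 - a\<^sup>2) / x\<^sup>2) / 2"
  have \<alpha>: "2 * \<alpha> * x\<^sup>2 = x\<^sup>2 + b\<^sup>2 - a\<^sup>2"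
    using ab by (simp add: \<alpha>_def field_simps)
  have pos: "0 < b\<^sup>2 - \<alpha>\<^sup>2 * x\<^sup>2"
  proof -
    \<comment> \<open>Heron's formula: both sides are 16 times the squared area, and the strict
      triangle inequalities make every factor positive.\<close>
    have "4 * x\<^sup>2 * (b\<^sup>2 - \<alpha>\<^sup>2 * x\<^sup>2) = (2 * b * x)\<^sup>2 - (2 * \<alpha> * x\<^sup>2)\<^sup>2"
      by (simp add: power2_eq_square algebra_simps)
    also have "\<dots> = (2 * b * x - (x\<^sup>2 + b\<^sup>2 - a\<^sup>2)) * (2 * b * x + (x\<^sup>2 + b\<^sup>2 - a\<^sup>2))"
      unfolding \<alpha> by (simp add: power2_eq_square algebra_simps)
    also have "\<dots> = ((a - (x - b)) * (a + (x - b))) * (((x + b) - a) * ((x + b) + a))"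
      by (simp add: power2_eq_square algebra_simps)
    also have "\<dots> > 0"
      using ab by (intro mult_pos_pos) auto
    finally show ?thesis using ab by (simp add: zero_less_mult_iff)
  qed
  define \<beta> where "\<beta> = sqrt (b\<^sup>2 - \<alpha>\<^sup>2 * x\<^sup>2)"
  have \<beta>: "\<beta> \<noteq> 0" "\<beta>\<^sup>2 = b\<^sup>2 - \<alpha>\<^sup>2 * x\<^sup>2" using pos by (auto simp: \<beta>_def)
  define v where "v = (\<lambda>k. \<alpha> * p k + (if k = n - 1 then \<beta> else 0))"
  have p0: "p (n - 1) = 0" "P i (n - 1) = 0" for i
    using PR(1) by (auto simp: p_def Rvec_def)
  have ipn: "ip n (\<lambda>k. t * p k + (if k = n - 1 then s else 0)) (\<lambda>k. t * p k + (if k = n - 1 then s else 0))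
      = t\<^sup>2 * x\<^sup>2 + s\<^sup>2" for t s
  proof -
    have "ip n (\<lambda>k. t * p k + (if k = n - 1 then s else 0)) (\<lambda>k. t * p k + (if k = n - 1 then s else 0))
      = (\<Sum>k<n. t\<^sup>2 * (p k * p k) + (if k = n - 1 then s\<^sup>2 else 0))"
      unfolding ip_def by (rule sum.cong) (use p0 in \<open>auto simp: power2_eq_square algebra_simps\<close>)
    also have "\<dots> = t\<^sup>2 * ip n p p + s\<^sup>2"
      using n by (simp add: sum.distrib ip_def sum_distrib_left)
    finally show ?thesis by (simp add: pp)
  qed
  define Q where "Q = P(n := v)"
  have Qn: "Q n = v" and Qi: "i \<noteq> n \<Longrightarrow> Q i = P i" for i by (auto simp: Q_def)
  have v: "v \<in> Rvec n"
    using PR(1)[of "n - 1"] n by (auto simp: v_def p_def Rvec_def)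
  have lpos': "\<forall>i\<in>{1..Suc n}. 0 < l i" using l by blast
  have QV: "Q \<in> polyV (Suc n) l n"
    unfolding polyV_iff[OF lpos']
  proof (intro conjI allI ballI impI)
    show "Q i \<in> Rvec n" for i
      using v PR(1)[of i] Rvec_mono[of "n - 1" n] by (cases "i = n") (auto simp: Qn Qi)
    show "Q 0 = (\<lambda>_. 0)" using PR(2) n by (simp add: Qi)
    show "Q i = (\<lambda>_. 0)" if "Suc n \<le> i" for i using PR(3)[of i] that by (simp add: Qi)
    fix i assume i: "i \<in> {1..Suc n}"
    consider "i < n" | "i = n" | "i = Suc n" using i by force
    then show "sq n (Q i) (Q (i - 1)) = (l i)\<^sup>2"
    proof cases
      case 1
      have "(\<lambda>k. P i k - P (i - 1) k) \<in> Rvec (n - 1)"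
        using PR(1) by (simp add: Rvec_def)
      then have "sq n (P i) (P (i - 1)) = sq (n - 1) (P i) (P (i - 1))"
        unfolding sq_def by (rule ip_Rvec_eq) simp
      then show ?thesis using 1 i Psq[of i] by (simp add: Qi)
    next
      case 2
      have "(\<lambda>k. Q n k - Q (n - 1) k) = (\<lambda>k. (\<alpha> - 1) * p k + (if k = n - 1 then \<beta> else 0))"
        using n by (auto simp: Qn Qi v_def p_def fun_eq_iff algebra_simps)
      then have "sq n (Q n) (Q (n - 1)) = (\<alpha> - 1)\<^sup>2 * x\<^sup>2 + \<beta>\<^sup>2"
        unfolding sq_def by (simp only: ipn)
      also have "\<dots> = a\<^sup>2"
        using \<alpha> unfolding \<beta>(2) by (simp add: power2_eq_square algebra_simps)
      finally show ?thesis using 2 by (simp add: a_def)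
    next
      case 3
      have "sq n (Q (Suc n)) (Q n) = ip n v v"
        using PR(3)[of "Suc n"] by (simp add: Qn Qi sq_zero sq_commute[of n "\<lambda>_. 0"])
      also have "\<dots> = \<alpha>\<^sup>2 * x\<^sup>2 + \<beta>\<^sup>2" unfolding v_def by (rule ipn)
      also have "\<dots> = b\<^sup>2" by (simp add: \<beta>)
      finally show ?thesis using 3 by (simp add: b_def)
    qed
  qed
  have "\<forall>i\<in>{1..<Suc n}. z i = 0" if z: "\<forall>k. (\<Sum>i\<in>{1..<Suc n}. z i * Q i k) = 0" for z
  proof -
    have S: "(\<Sum>i\<in>{1..<Suc n}. z i * Q i k) = (\<Sum>i\<in>{1..<n}. z i * P i k) + z n * v k" for k
      using n by (simp add: sum.atLeastLessThan_Suc Qn Qi)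
    have "z n * \<beta> = 0"
      using z[rule_format, of "n - 1"] unfolding S by (simp add: p0 v_def del: One_nat_def)
    then have zn: "z n = 0" using \<beta> by simp
    then have "\<forall>k. (\<Sum>i\<in>{1..<n}. z i * P i k) = 0" using z unfolding S by simp
    then have "\<forall>i\<in>{1..<n}. z i = 0" using P unfolding generic_polygon_def by blast
    then show ?thesis using zn by (auto simp: less_Suc_eq)
  qed
  then have "generic_polygon (Suc n) l Q"
    using QV by (simp add: generic_polygon_def)
  then show ?thesis by blast
qed

text \<open>A segment traversed back and forth. Such a digon does not belong to
  \<open>intC 2\<close>, so triangles, not digons, are the base of the later induction; they arise
  from this digon by one erection step.\<close>

lemma generic_polygon_2:
  assumes "0 < l 1" "l 2 = l 1"
  shows "\<exists>P. generic_polygon 2 l P"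
proof -
  define P where "P = (\<lambda>i k :: nat. if i = (1 :: nat) \<and> k = 0 then l 1 else 0 :: real)"
  have I: "{1..2} = {1, 2 :: nat}" "{1..<2} = {1 :: nat}" by auto
  have pos: "\<forall>i\<in>{1..2}. 0 < l i" using assms unfolding I by auto
  have "P \<in> polyV 2 l (2 - 1)"
    using assms unfolding polyV_iff[of 2 l, OF pos] I
    by (auto simp: P_def Rvec_def sq_def ip_def power2_eq_square)
  then have "generic_polygon 2 l P"
    using assms unfolding generic_polygon_def I by (auto simp: P_def)
  then show ?thesis by blast
qed

text \<open>A short diagonal \<open>x\<close> has to close a nondegenerate triangle with the last
  two sides and still leave strict inequalities for the remaining \<open>n\<close>-gon.
  \<open>A\<close> collects the lower bounds on \<open>x\<close> and \<open>U\<close> is the least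
  upper bound required; every lower bound lies below \<open>U\<close>, so the midpoint
  works.\<close>

lemma cut_triangle:
  assumes n: "3 \<le> n" and l: "l \<in> intC (Suc n)"
  shows "\<exists>x. \<bar>l n - l (Suc n)\<bar> < x \<and> x < l n + l (Suc n) \<and> l(n := x) \<in> intC n"
proof -
  define a b T where "a = l n" and "b = l (Suc n)" and "T = sum l {1..<n}"
  have S: "sum l {1..Suc n} = T + a + b"
    using n by (simp add: a_def b_def T_def atLeastLessThanSuc_atLeastAtMost[symmetric])
  have pos: "0 < l i" and tri: "2 * l i < T + a + b" if "i \<in> {1..Suc n}" for i
    using l that unfolding intC_iff S by auto
  have ab: "0 < a" "0 < b" "\<bar>a - b\<bar> < T"
    using pos[of n] pos[of "Suc n"] tri[of n] tri[of "Suc n"] n by (auto simp: a_def b_def)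
  \<comment> \<open>Here at least two sides must precede the last two: the other one makes the
    inequality strict.\<close>
  have lT: "l i < T" if "i \<in> {1..<n}" for i
  proof -
    obtain j where j: "j \<in> {1..<n}" "j \<noteq> i"
      using n by (intro that[of "if i = 1 then 2 else 1"]) auto
    have "l i < sum l {i, j}" using j pos[of j] by simp
    also have "\<dots> \<le> T"
      unfolding T_def using j that pos by (intro sum_mono2) (auto intro: less_imp_le)
    finally show ?thesis .
  qed
  define A where "A = insert \<bar>a - b\<bar> ((\<lambda>i. 2 * l i - T) ` {1..<n})"
  define L where "L = Max A"
  define U where "U = min (a + b) T"
  have A: "finite A" "A \<noteq> {}" by (auto simp: A_def)
  have "t < U" if "t \<in> A" for t
    using that ab lT tri unfolding A_def U_def by fastforce
  then have LU: "L < U" using Max_in[OF A] by (simp add: L_def)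
  have L: "t \<le> L" if "t \<in> A" for t using A that by (simp add: L_def)
  define x where "x = (L + U) / 2"
  have x: "L < x" "x < U" using LU by (auto simp: x_def)
  have x1: "\<bar>a - b\<bar> < x" using L[of "\<bar>a - b\<bar>"] x by (simp add: A_def)
  have x2: "2 * l i - T < x" if "i \<in> {1..<n}" for i using L[of "2 * l i - T"] x that by (auto simp: A_def)
  have S': "sum (l(n := x)) {1..n} = T + x"
  proof -
    have "sum (l(n := x)) {1..n} = sum (l(n := x)) {1..<n} + x"
      using n by (simp add: atLeastLessThanSuc_atLeastAtMost[symmetric])
    also have "sum (l(n := x)) {1..<n} = T" unfolding T_def by (rule sum.cong) auto
    finally show ?thesis .
  qed
  have "l(n := x) \<in> intC n"
    unfolding intC_iff S'
  proof
    fix i assume i: "i \<in> {1..n}"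
    show "0 < (l(n := x)) i \<and> 2 * (l(n := x)) i < T + x"
    proof (cases "i = n")
      case True
      then show ?thesis using x x1 by (simp add: U_def)
    next
      case False
      then show ?thesis using i pos[of i] x2[of i] by simp
    qed
  qed
  then show ?thesis
    using x x1 by (intro exI[of _ x]) (auto simp: U_def a_def b_def)
qed

lemma generic_polygon_exists:
  assumes "3 \<le> n" "l \<in> intC n"
  shows "\<exists>P. generic_polygon n l P"
  using assms
proof (induction n arbitrary: l rule: nat_induct_at_least)
  case base
  have I: "{1..3} = {1, 2, 3 :: nat}" by auto
  have l: "0 < l 1" "0 < l 2" "0 < l 3" "l 1 < l 2 + l 3" "l 2 < l 1 + l 3" "l 3 < l 1 + l 2"
    using base unfolding intC_iff I by auto
  have "\<exists>P. generic_polygon 2 (l(2 := l 1)) P"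
    using l by (intro generic_polygon_2) auto
  moreover have "0 < l i" if "i \<in> {1..Suc 2}" for i
    using that base unfolding intC_iff by auto
  ultimately show ?case
    using generic_polygon_Suc[of 2 l "l 1"] l by (auto simp: numeral_3_eq_3 numeral_2_eq_2)
next
  case (Suc n)
  obtain x where x: "\<bar>l n - l (Suc n)\<bar> < x" "x < l n + l (Suc n)" "l(n := x) \<in> intC n"
    using cut_triangle Suc by blast
  obtain P where "generic_polygon n (l(n := x)) P"
    using Suc.IH x by blast
  moreover have "0 < l i" if "i \<in> {1..Suc n}" for i
    using that Suc.prems unfolding intC_iff by auto
  ultimately show ?case
    using generic_polygon_Suc[of n l x P] x Suc.hyps by auto
qed

section \<open>Coordinates on the space of Gram matrices\<close>

lemma continuous_on_coord2 [continuous_intros]: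
  "continuous_on S (\<lambda>P :: nat \<Rightarrow> nat \<Rightarrow> real. P i k)"
  by (rule continuous_on_compose2[OF continuous_on_coord[of UNIV k] continuous_on_coord[of S i]]) simp

lemma continuous_on_mdet:
  assumes "\<And>a b. continuous_on S (\<lambda>x. M x a b)"
  shows "continuous_on S (\<lambda>x. mdet d (M x))"
  unfolding mdet_def by (intro continuous_intros assms)

locale polygon_space =
  fixes n :: nat and l :: "nat \<Rightarrow> real"
  assumes n3: "3 \<le> n" and lC: "l \<in> intC n"
begin

definition m :: nat where "m = n - 1"

lemma n_Suc: "n = Suc m" and m2: "2 \<le> m"
  using n3 by (auto simp: m_def)

lemma l_pos: "\<forall>i\<in>{1..n}. 0 < l i"
  using lC by (simp add: intC_def)

abbreviation V :: "nat \<Rightarrow> (nat \<Rightarrow> nat \<Rightarrow> real) set" where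
  "V d \<equiv> polyV n l d"

lemma V_Rvec: "P \<in> V d \<Longrightarrow> P i \<in> Rvec d"
  and V_0: "P \<in> V d \<Longrightarrow> P 0 = (\<lambda>_. 0)"
  and V_ge: "P \<in> V d \<Longrightarrow> n \<le> i \<Longrightarrow> P i = (\<lambda>_. 0)"
  by (simp_all add: polyV_def)

lemma V_side: "P \<in> V d \<Longrightarrow> i < n \<Longrightarrow> sq d (P i) (P (Suc i)) = (l (Suc i))\<^sup>2"
  using polyV_iff[OF l_pos, of P d] by (subst sq_commute) force

lemma polygon_eqI:
  fixes P Q :: "nat \<Rightarrow> nat \<Rightarrow> real"
  assumes "P 0 = Q 0" "\<And>i. n \<le> i \<Longrightarrow> P i = Q i" "\<And>i. i < m \<Longrightarrow> P (Suc i) = Q (Suc i)"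
  shows "P = Q"
proof
  fix i
  consider "i = 0" | j where "i = Suc j" "j < m" | "n \<le> i"
    by (metis not0_implies_Suc Suc_less_eq n_Suc not_less)
  then show "P i = Q i"
    using assms by cases auto
qed

text \<open>Since v_n is identified with v_0, the pair \<open>(0, m)\<close> is the closing side and
  not a diagonal.\<close>

definition diagonals :: "(nat \<times> nat) set" where
  "diagonals = {(i, j). i < j \<and> j < n \<and> j \<noteq> Suc i \<and> (i, j) \<noteq> (0, m)}"

definition D :: nat where "D = card diagonals"

definition diag :: "nat \<Rightarrow> nat \<times> nat" where
  "diag = (SOME e. bij_betw e {..<D} diagonals)"

lemma bij_diag: "bij_betw diag {..<D} diagonals"
proof -
  have "finite diagonals"
    by (rule finite_subset[of _ "{..<n} \<times> {..<n}"]) (auto simp: diagonals_def)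
  then have "\<exists>e. bij_betw e {..<D} diagonals"
    using ex_bij_betw_nat_finite by (auto simp: D_def lessThan_atLeast0)
  then show ?thesis unfolding diag_def by (rule someI_ex)
qed

lemma diag_in: "k < D \<Longrightarrow> diag k \<in> diagonals"
  using bij_diag by (auto simp: bij_betw_def)

definition rho :: "nat \<Rightarrow> (nat \<Rightarrow> nat \<Rightarrow> real) \<Rightarrow> nat \<Rightarrow> real" where
  "rho d P = (\<lambda>k. if k < D then sq d (P (fst (diag k))) (P (snd (diag k))) else 0)"

lemma rho_Rvec: "rho d P \<in> Rvec D"
  by (simp add: rho_def Rvec_def)

text \<open>The constant term of the affine function \<open>dist2\<close>: symmetric in its
  arguments, and zero on diagonals and on equal indices.\<close>

definition side :: "nat \<Rightarrow> nat \<Rightarrow> real" where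
  "side i j = (if j = Suc i then (l j)\<^sup>2 else if i = Suc j then (l i)\<^sup>2
     else if (min i j, max i j) = (0, m) then (l n)\<^sup>2 else 0)"

definition inc :: "nat \<Rightarrow> nat \<Rightarrow> nat \<Rightarrow> real" where
  "inc k i j = (if diag k = (min i j, max i j) then 1 else 0)"

text \<open>The squared distance between the i-th and the j-th vertex, in terms of the squared
  lengths x of the diagonals.\<close>
definition dist2 :: "(nat \<Rightarrow> real) \<Rightarrow> nat \<Rightarrow> nat \<Rightarrow> real" where
  "dist2 x i j = side i j + (\<Sum>k<D. x k * inc k i j)"

lemma inc_eq_0:
  assumes "(min i j, max i j) \<notin> diagonals" "k < D"
  shows "inc k i j = 0"
  using diag_in[OF assms(2)] assms(1) by (auto simp: inc_def)

lemma dist2_not_diagonal: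
  assumes "(min i j, max i j) \<notin> diagonals"
  shows "dist2 x i j = side i j"
  using inc_eq_0[OF assms] by (simp add: dist2_def)

lemma dist2_self: "dist2 x i i = 0"
  using m2 by (subst dist2_not_diagonal) (auto simp: diagonals_def side_def)

lemma dist2_sym: "dist2 x i j = dist2 x j i"
  by (simp add: dist2_def side_def inc_def min.commute max.commute)

lemma dist2_side: "dist2 x i (Suc i) = (l (Suc i))\<^sup>2"
  by (subst dist2_not_diagonal) (auto simp: diagonals_def side_def)

lemma dist2_closing: "dist2 x 0 m = (l n)\<^sup>2"
  using m2 by (subst dist2_not_diagonal) (auto simp: diagonals_def side_def)

lemma dist2_diag:
  assumes "k < D"
  shows "dist2 x (fst (diag k)) (snd (diag k)) = x k"
proof -
  obtain i j where ij: "diag k = (i, j)" by fastforce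
  then have d: "(i, j) \<in> diagonals" using diag_in[OF assms] by simp
  then have mm: "min i j = i" "max i j = j" by (auto simp: diagonals_def)
  have "(diag k' = diag k) = (k' = k)" if "k' < D" for k'
    using bij_diag assms that by (auto simp: bij_betw_def inj_on_def)
  then have "(\<Sum>k'<D. x k' * inc k' i j) = (\<Sum>k'<D. if k' = k then x k' else 0)"
    unfolding inc_def mm ij[symmetric] by (intro sum.cong) auto
  then have "(\<Sum>k'<D. x k' * inc k' i j) = x k"
    using assms by simp
  moreover have "side i j = 0" using d mm by (auto simp: side_def diagonals_def)
  ultimately show ?thesis by (simp add: dist2_def ij)
qed

lemma dist2_rho:
  assumes P: "P \<in> V d" and "i < n" "j < n"
  shows "dist2 (rho d P) i j = sq d (P i) (P j)"
proof -
  have lt: "dist2 (rho d P) i j = sq d (P i) (P j)" if ij: "i < j" "j < n" for i j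
  proof -
    consider "(i, j) \<in> diagonals" | "j = Suc i" | "i = 0" "j = m"
      using ij by (auto simp: diagonals_def)
    then show ?thesis
    proof cases
      case 1
      then obtain k where "k < D" "diag k = (i, j)"
        using bij_betw_imp_surj_on[OF bij_diag] by (metis imageE lessThan_iff)
      then show ?thesis using dist2_diag[of k "rho d P"] by (simp add: rho_def)
    next
      case 2
      then show ?thesis using V_side[OF P, of i] ij by (simp add: dist2_side)
    next
      case 3
      then show ?thesis
        using V_side[OF P, of m] V_0[OF P] V_ge[OF P, of "Suc m"] n_Suc
        by (simp add: dist2_closing sq_commute)
    qed
  qed
  show ?thesis
  proof (cases i j rule: linorder_cases)
    case less
    then show ?thesis using \<open>j < n\<close> by (rule lt)
  next
    case equal
    then show ?thesis by (simp add: dist2_self sq_self)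
  next
    case greater
    then show ?thesis using \<open>i < n\<close> by (metis dist2_sym sq_commute lt)
  qed
qed

text \<open>Polarization at vertex 0, meaningful for every \<open>x\<close> whether or not a polygon
  realizes it. Index \<open>i\<close> stands for vertex \<open>Suc i\<close>.\<close>

definition gram :: "(nat \<Rightarrow> real) \<Rightarrow> nat \<Rightarrow> nat \<Rightarrow> real" where
  "gram x i j = (dist2 x (Suc i) 0 + dist2 x (Suc j) 0 - dist2 x (Suc i) (Suc j)) / 2"

lemma gram_rho:
  assumes "P \<in> V d" "i < m" "j < m"
  shows "gram (rho d P) i j = ip d (P (Suc i)) (P (Suc j))"
proof -
  have "Suc i < n" "Suc j < n" "0 < n" using assms n_Suc by auto
  then show ?thesis
    unfolding gram_def dist2_rho[OF assms(1) \<open>Suc i < n\<close> \<open>0 < n\<close>]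
      dist2_rho[OF assms(1) \<open>Suc j < n\<close> \<open>0 < n\<close>] dist2_rho[OF assms(1) \<open>Suc i < n\<close> \<open>Suc j < n\<close>]
      V_0[OF assms(1)] sq_zero
    by (simp add: sq_def ip_diff)
qed

definition quad :: "(nat \<Rightarrow> real) \<Rightarrow> (nat \<Rightarrow> real) \<Rightarrow> real" where
  "quad x z = (\<Sum>i<m. \<Sum>j<m. z i * z j * gram x i j)"

definition comb :: "(nat \<Rightarrow> nat \<Rightarrow> real) \<Rightarrow> (nat \<Rightarrow> real) \<Rightarrow> nat \<Rightarrow> real" where
  "comb P z = (\<lambda>k. \<Sum>i<m. z i * P (Suc i) k)"

lemma quad_rho:
  assumes "P \<in> V d"
  shows "quad (rho d P) z = ip d (comb P z) (comb P z)"
proof -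
  have "ip d (comb P z) (comb P z) = (\<Sum>k<d. \<Sum>i<m. \<Sum>j<m. z i * z j * (P (Suc i) k * P (Suc j) k))"
    unfolding ip_def comb_def by (intro sum.cong refl) (simp add: sum_product mult_ac)
  also have "\<dots> = (\<Sum>i<m. \<Sum>j<m. z i * z j * ip d (P (Suc i)) (P (Suc j)))"
    by (subst sum.swap, rule sum.cong[OF refl], subst sum.swap) (simp add: sum_distrib_left ip_def)
  also have "\<dots> = quad (rho d P) z"
    unfolding quad_def using gram_rho[OF assms] by (intro sum.cong refl) auto
  finally show ?thesis ..
qed

lemma comb_Rvec: "P \<in> V d \<Longrightarrow> comb P z \<in> Rvec d"
  using V_Rvec[of P d] by (auto simp: comb_def Rvec_def)

text \<open>The coefficient of the coordinate \<open>x k\<close> in the affine function sending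
  \<open>x\<close> to \<open>quad x z\<close>.\<close>

definition lin :: "nat \<Rightarrow> (nat \<Rightarrow> real) \<Rightarrow> real" where
  "lin k z = (\<Sum>i<m. \<Sum>j<m. z i * z j * ((inc k (Suc i) 0 + inc k (Suc j) 0 - inc k (Suc i) (Suc j)) / 2))"

lemma quad_add: "quad (\<lambda>k. x k + y k) z = quad x z + (\<Sum>k<D. y k * lin k z)"
proof -
  have "gram (\<lambda>k. x k + y k) i j = gram x i j
      + (\<Sum>k<D. y k * ((inc k (Suc i) 0 + inc k (Suc j) 0 - inc k (Suc i) (Suc j)) / 2))" for i j
    unfolding gram_def dist2_def
    by (simp add: sum.distrib sum_subtractf algebra_simps sum_divide_distrib[symmetric] diff_divide_distrib add_divide_distrib)
  then have "quad (\<lambda>k. x k + y k) z = quad x z + (\<Sum>i<m. \<Sum>j<m. \<Sum>k<D.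
      y k * (z i * z j * ((inc k (Suc i) 0 + inc k (Suc j) 0 - inc k (Suc i) (Suc j)) / 2)))"
    unfolding quad_def by (simp only: distrib_left sum.distrib sum_distrib_left mult.left_commute)
  also have "(\<Sum>i<m. \<Sum>j<m. \<Sum>k<D.
      y k * (z i * z j * ((inc k (Suc i) 0 + inc k (Suc j) 0 - inc k (Suc i) (Suc j)) / 2)))
      = (\<Sum>k<D. \<Sum>i<m. \<Sum>j<m.
      y k * (z i * z j * ((inc k (Suc i) 0 + inc k (Suc j) 0 - inc k (Suc i) (Suc j)) / 2)))"
    by (subst (2) sum.swap, subst sum.swap) simp
  also have "\<dots> = (\<Sum>k<D. y k * lin k z)"
    by (simp add: lin_def sum_distrib_left)
  finally show ?thesis .
qed

text \<open>By homogeneity of \<open>quad\<close> in \<open>z\<close> the unit sphere suffices for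
  testing definiteness, and its compactness is what \<open>gauge_exists\<close> needs.\<close>

definition Sph :: "(nat \<Rightarrow> real) set" where
  "Sph = {z \<in> Rvec m. ip m z z = 1}"

lemma Sph_nonempty: "Sph \<noteq> {}"
proof -
  have "(\<lambda>k. if k = 0 then 1 else 0) \<in> Sph"
    using m2 by (auto simp: Sph_def Rvec_def ip_def if_distrib[of "\<lambda>x. x * _"] cong: if_cong)
  then show ?thesis by blast
qed

lemma Sph_nonzero: "z \<in> Sph \<Longrightarrow> z \<noteq> (\<lambda>_. 0)"
  by (auto simp: Sph_def ip_def)

lemma normalize_Sph:
  assumes "z \<in> Rvec m" "z \<noteq> (\<lambda>_. 0)"
  shows "(\<lambda>k. z k / sqrt (ip m z z)) \<in> Sph"
proof -
  have "0 < ip m z z" using assms ip_pos by blast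
  moreover have "ip m (\<lambda>k. z k / sqrt (ip m z z)) (\<lambda>k. z k / sqrt (ip m z z)) = ip m z z / (sqrt (ip m z z) * sqrt (ip m z z))"
    unfolding ip_def[of m "\<lambda>k. z k / _"] ip_def[of m z z] by (simp add: sum_divide_distrib)
  ultimately show ?thesis
    using assms by (simp add: Sph_def Rvec_def)
qed

lemma compact_Sph: "compact Sph"
proof -
  have "compact {z :: nat \<Rightarrow> real. \<forall>k. z k \<in> {-1..1}}"
    by (rule compact_fun_box) simp
  moreover have "closed Sph"
  proof -
    have "Sph = Rvec m \<inter> {z. ip m z z = 1}" by (auto simp: Sph_def)
    moreover have "closed {z. ip m z z = 1}"
      unfolding ip_def by (intro closed_Collect_eq continuous_intros)
    ultimately show ?thesis using closed_Rvec by auto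
  qed
  ultimately have "compact ({z. \<forall>k. z k \<in> {-1..1}} \<inter> Sph)"
    by (rule compact_Int_closed)
  moreover have "z k \<in> {-1..1}" if "z \<in> Sph" for z k
  proof (cases "k < m")
    case True
    have "z k * z k \<le> ip m z z"
      unfolding ip_def using True by (intro member_le_sum) auto
    then have "(z k)\<^sup>2 \<le> 1" using that by (simp add: Sph_def power2_eq_square)
    then show ?thesis by (auto simp: abs_square_le_1)
  next
    case False
    then show ?thesis using that by (auto simp: Sph_def Rvec_def)
  qed
  then have "{z. \<forall>k. z k \<in> {-1..1}} \<inter> Sph = Sph" by blast
  ultimately show ?thesis by simp
qed

lemma quad_nonneg:
  assumes "\<forall>z\<in>Sph. 0 \<le> quad x z"
  shows "0 \<le> quad x z"
proof -
  define y where "y = (\<lambda>k. if k < m then z k else 0)"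
  have y: "y \<in> Rvec m" by (simp add: y_def Rvec_def)
  have yz: "quad x z = quad x y"
    unfolding quad_def by (intro sum.cong refl) (simp add: y_def)
  show ?thesis
  proof (cases "y = (\<lambda>_. 0)")
    case True
    then show ?thesis unfolding yz by (simp add: quad_def)
  next
    case False
    define s where "s = sqrt (ip m y y)"
    have s: "0 < s" using ip_pos[OF y False] by (simp add: s_def)
    have "quad x (\<lambda>k. y k / s) = (\<Sum>i<m. \<Sum>j<m. y i * y j * gram x i j / (s * s))"
      unfolding quad_def by (intro sum.cong refl) simp
    also have "\<dots> = quad x y / (s * s)"
      unfolding quad_def by (simp add: sum_divide_distrib)
    finally have "0 \<le> quad x y / (s * s)"
      using assms normalize_Sph[OF y False] s_def by auto
    then show ?thesis using s yz by (simp add: zero_le_divide_iff mult_le_0_iff)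
  qed
qed

definition K :: "(nat \<Rightarrow> real) set" where
  "K = {x \<in> Rvec D. \<forall>z\<in>Sph. 0 \<le> quad x z}"

lemma rho_in_K: "P \<in> V d \<Longrightarrow> rho d P \<in> K"
  by (simp add: K_def rho_Rvec quad_rho ip_nonneg)

text \<open>Factoring the Gram matrix gives vectors in R^m, hence in R^d. Polarization recovers all
  the prescribed distances \<open>dist2\<close>, among them the sides and the closing side, so the
  vectors are the vertices of a polygon with the right diagonals.\<close>

lemma K_realize:
  assumes x: "x \<in> K" and d: "m \<le> d"
  shows "\<exists>P\<in>V d. rho d P = x"
proof -
  have "gram x i j = gram x j i" for i j
    by (simp add: gram_def dist2_sym[of x "Suc i" "Suc j"])
  moreover have "0 \<le> (\<Sum>i<m. \<Sum>j<m. z i * z j * gram x i j)" for z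
    using quad_nonneg[of x z] x by (simp add: K_def quad_def)
  ultimately obtain v where v: "\<And>i. i < m \<Longrightarrow> v i \<in> Rvec m"
      "\<And>i j. i < m \<Longrightarrow> j < m \<Longrightarrow> ip m (v i) (v j) = gram x i j"
    using psd_imp_Gram[of m "gram x"] by metis
  define P where "P = (\<lambda>i. if 0 < i \<and> i < n then v (i - 1) else (\<lambda>_. 0))"
  have Pm: "P i \<in> Rvec m" for i
    using v(1)[of "i - 1"] n_Suc by (auto simp: P_def Rvec_def)
  have g0: "gram x i i = dist2 x (Suc i) 0" for i by (simp add: gram_def dist2_self)
  have ipP: "ip d (P i) (P j) = ip m (P i) (P j)" for i j
    by (rule ip_Rvec_eq[OF Pm d])
  have PS: "P (Suc i) = v i" if "i < m" for i using that n_Suc by (simp add: P_def)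
  have P0: "P 0 = (\<lambda>_. 0)" by (simp add: P_def)
  have dist: "sq d (P i) (P j) = dist2 x i j" if ij: "i < n" "j < n" for i j
  proof (cases i)
    case 0
    show ?thesis
    proof (cases j)
      case 0
      then show ?thesis using \<open>i = 0\<close> by (simp add: sq_self dist2_self)
    next
      case (Suc j')
      then show ?thesis using \<open>i = 0\<close> ij n_Suc v(2)[of j' j']
        by (simp add: sq_commute[of d "\<lambda>_. 0"] P0 sq_zero ip_Rvec_eq[OF v(1) d] PS g0 dist2_sym)
    qed
  next
    case (Suc i')
    then have i': "i' < m" using ij n_Suc by simp
    show ?thesis
    proof (cases j)
      case 0
      then show ?thesis using Suc i' v(2)[of i' i']
        by (simp add: P0 sq_zero ip_Rvec_eq[OF v(1) d] PS g0)
    next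
      case j: (Suc j')
      then have j': "j' < m" using ij n_Suc by simp
      have "sq d (P i) (P j) = gram x i' i' + gram x j' j' - 2 * gram x i' j'"
        unfolding sq_def ip_diff ipP using Suc j i' j' v(2) by (simp add: PS)
      also have "\<dots> = dist2 x i j"
        using Suc j by (simp add: g0 gram_def[of x i' j'] field_simps)
      finally show ?thesis .
    qed
  qed
  have PV: "P \<in> V d"
    unfolding polyV_iff[OF l_pos]
  proof (intro conjI allI ballI impI)
    show "P i \<in> Rvec d" for i using Pm Rvec_mono[OF d] by blast
    show "P i = (\<lambda>_. 0)" if "n \<le> i" for i using that by (simp add: P_def)
    fix i assume i: "i \<in> {1..n}"
    show "sq d (P i) (P (i - 1)) = (l i)\<^sup>2"
    proof (cases "i = n")
      case True
      moreover have "P n = P 0" by (simp add: P_def)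
      ultimately have "sq d (P i) (P (i - 1)) = sq d (P 0) (P m)"
        by (simp add: m_def)
      then show ?thesis using dist[of 0 m] n_Suc True by (simp add: dist2_closing)
    next
      case False
      then have "i - 1 < n" "i < n" "Suc (i - 1) = i" using i by auto
      then show ?thesis
        using dist[of "i - 1" i] dist2_side[of x "i - 1"] by (simp add: sq_commute)
    qed
  qed (rule P0)
  moreover have "rho d P = x"
  proof
    fix k
    show "rho d P k = x k"
    proof (cases "k < D")
      case True
      then have "fst (diag k) < n" "snd (diag k) < n"
        using diag_in[OF True] by (auto simp: diagonals_def)
      then show ?thesis using True by (simp add: rho_def dist dist2_diag)
    next
      case False
      then show ?thesis using x by (simp add: rho_def K_def Rvec_def)
    qed
  qed
  ultimately show ?thesis by blast
qed

lemma rho_image: "m \<le> d \<Longrightarrow> rho d ` V d = K"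
  using K_realize rho_in_K by blast

section \<open>Compactness of the polygon space\<close>

lemma V_coord_bound:
  assumes P: "P \<in> V d"
  shows "\<bar>P i k\<bar> \<le> sum l {1..n}"
proof -
  have step: "\<bar>P (Suc i) k - P i k\<bar> \<le> l (Suc i)" if "i < n" for i
  proof (cases "k < d")
    case True
    have "(P (Suc i) k - P i k)\<^sup>2 \<le> sq d (P i) (P (Suc i))"
      unfolding sq_commute[of d "P i"] unfolding sq_def ip_def power2_eq_square
      using True by (intro member_le_sum) auto
    also have "\<dots> = (l (Suc i))\<^sup>2" using V_side[OF P that] .
    finally have "\<bar>P (Suc i) k - P i k\<bar> \<le> \<bar>l (Suc i)\<bar>"
      by (simp add: abs_le_square_iff)
    then show ?thesis using l_pos[rule_format, of "Suc i"] that by simp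
  next
    case False
    then show ?thesis
      using V_Rvec[OF P] l_pos[rule_format, of "Suc i"] that by (simp add: Rvec_def)
  qed
  have b: "\<bar>P i k\<bar> \<le> sum l {1..i}" if "i \<le> n" for i
    using that
  proof (induction i)
    case 0
    then show ?case using V_0[OF P] by simp
  next
    case (Suc i)
    then show ?case using step[of i] by simp
  qed
  show ?thesis
  proof (cases "i \<le> n")
    case True
    have "sum l {1..i} \<le> sum l {1..n}"
      using True l_pos by (intro sum_mono2) (auto intro: less_imp_le)
    then show ?thesis using b[OF True] by linarith
  next
    case False
    moreover have "0 \<le> sum l {1..n}"
      using l_pos by (intro sum_nonneg) (auto intro: less_imp_le)
    ultimately show ?thesis using V_ge[OF P, of i] by simp
  qed
qed

lemma compact_V: "compact (V d)"
proof -
  define B where "B = sum l {1..n}"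
  have "compact {P :: nat \<Rightarrow> nat \<Rightarrow> real. \<forall>i. P i \<in> {x. \<forall>k. x k \<in> {-B..B}}}"
    by (intro compact_fun_box) simp
  moreover have "closed (V d)"
  proof -
    have "V d = (\<Inter>i. \<Inter>k\<in>{d..}. {P. P i k = 0}) \<inter> (\<Inter>k. {P. P 0 k = 0}) \<inter> (\<Inter>i\<in>{n..}. \<Inter>k. {P. P i k = 0})
        \<inter> (\<Inter>i\<in>{1..n}. {P. sq d (P i) (P (i - 1)) = (l i)\<^sup>2})"
      unfolding set_eq_iff polyV_iff[OF l_pos] by (auto simp: Rvec_def fun_eq_iff)
    moreover have "closed {P :: nat \<Rightarrow> nat \<Rightarrow> real. P i k = 0}" for i k
      by (intro closed_Collect_eq continuous_intros)
    moreover have "closed {P :: nat \<Rightarrow> nat \<Rightarrow> real. sq d (P i) (P j) = r}" for i j r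
      unfolding sq_def ip_def by (intro closed_Collect_eq continuous_intros)
    ultimately show ?thesis by (auto intro!: closed_Int closed_INT)
  qed
  ultimately have "compact ({P. \<forall>i. P i \<in> {x. \<forall>k. x k \<in> {-B..B}}} \<inter> V d)"
    by (rule compact_Int_closed)
  moreover have "P i k \<in> {-B..B}" if "P \<in> V d" for P i k
    using V_coord_bound[OF that, of i k] by (simp add: B_def abs_le_iff)
  then have "{P. \<forall>i. P i \<in> {x. \<forall>k. x k \<in> {-B..B}}} \<inter> V d = V d" by blast
  ultimately show ?thesis by simp
qed

lemma continuous_on_rho: "continuous_on S (rho d)"
proof (rule continuous_on_coordinatewise_then_product)
  show "continuous_on S (\<lambda>P. rho d P k)" for k
    by (cases "k < D") (auto simp: rho_def sq_def ip_def intro!: continuous_intros)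
qed

end

section \<open>Orbits of polygons\<close>

context polygon_space
begin

text \<open>The determinant of the d x d matrix R^T P, a stand-in for the maximal minors of P that needs no
  choice of rows: its sign tells the two SO(d)-orbits with the same Gram matrix apart.\<close>
definition gdet :: "nat \<Rightarrow> (nat \<Rightarrow> nat \<Rightarrow> real) \<Rightarrow> (nat \<Rightarrow> nat \<Rightarrow> real) \<Rightarrow> real" where
  "gdet d R P = mdet d (\<lambda>a b. \<Sum>i<m. R (Suc i) a * P (Suc i) b)"

lemma gdet_mact: "gdet d R (\<lambda>i. mact d A (P i)) = mdet d A * gdet d R P"
proof -
  have "gdet d R (\<lambda>i. mact d A (P i)) =
      mdet d (mmul d (\<lambda>a b. \<Sum>i<m. R (Suc i) a * P (Suc i) b) (\<lambda>i j. A j i))"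
    unfolding gdet_def
  proof (rule mdet_cong)
    fix a b assume "a < d" "b < d"
    then have "(\<Sum>i<m. R (Suc i) a * mact d A (P (Suc i)) b) =
        (\<Sum>i<m. \<Sum>c<d. R (Suc i) a * (A b c * P (Suc i) c))"
      by (simp add: mact_def sum_distrib_left)
    also have "\<dots> = (\<Sum>c<d. \<Sum>i<m. R (Suc i) a * (A b c * P (Suc i) c))"
      by (rule sum.swap)
    also have "\<dots> = mmul d (\<lambda>a b. \<Sum>i<m. R (Suc i) a * P (Suc i) b) (\<lambda>i j. A j i) a b"
      unfolding mmul_def sum_distrib_right by (intro sum.cong refl) (simp add: mult_ac)
    finally show "(\<Sum>i<m. R (Suc i) a * mact d A (P (Suc i)) b) =
        mmul d (\<lambda>a b. \<Sum>i<m. R (Suc i) a * P (Suc i) b) (\<lambda>i j. A j i) a b" .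
  qed
  then show ?thesis
    unfolding gdet_def mdet_mmul by (simp add: mdet_transpose[of d A])
qed

lemma continuous_on_gdet: "continuous_on S (gdet d R)"
  unfolding gdet_def by (intro continuous_on_mdet continuous_intros)

text \<open>The polygon lies in a hyperplane through the origin, so the reflection in
  \<open>u\<close> fixes it and orientation carries no information.\<close>

definition degenerate :: "nat \<Rightarrow> (nat \<Rightarrow> nat \<Rightarrow> real) \<Rightarrow> bool" where
  "degenerate d P \<longleftrightarrow> (\<exists>u\<in>Rvec d. u \<noteq> (\<lambda>_. 0) \<and> (\<forall>i<m. ip d u (P (Suc i)) = 0))"

lemma gdet_kernel:
  assumes "gdet d R Q = 0"
  shows "\<exists>u\<in>Rvec d. u \<noteq> (\<lambda>_. 0) \<and> (\<forall>a<d. (\<Sum>i<m. ip d u (Q (Suc i)) * R (Suc i) a) = 0)"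
proof -
  obtain u where u: "u \<in> Rvec d" "u \<noteq> (\<lambda>_. 0)"
      "\<forall>a<d. (\<Sum>b<d. (\<Sum>i<m. R (Suc i) a * Q (Suc i) b) * u b) = 0"
    using assms unfolding gdet_def mdet_eq_0_iff by blast
  have "(\<Sum>b<d. (\<Sum>i<m. R (Suc i) a * Q (Suc i) b) * u b) = (\<Sum>i<m. ip d u (Q (Suc i)) * R (Suc i) a)" for a
    unfolding ip_def sum_distrib_right by (subst sum.swap) (simp add: mult_ac)
  then show ?thesis using u by metis
qed

lemma gdet_self_eq_0:
  assumes "gdet d Q Q = 0"
  shows "degenerate d Q"
proof -
  obtain u where u: "u \<in> Rvec d" "u \<noteq> (\<lambda>_. 0)"
      "\<forall>a<d. (\<Sum>i<m. ip d u (Q (Suc i)) * Q (Suc i) a) = 0"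
    using gdet_kernel[OF assms] by blast
  \<comment> \<open>Pairing the kernel equation with \<open>u\<close> itself produces a sum of
    squares.\<close>
  have "(\<Sum>i<m. ip d u (Q (Suc i)) * ip d u (Q (Suc i))) = (\<Sum>a<d. u a * (\<Sum>i<m. ip d u (Q (Suc i)) * Q (Suc i) a))"
    unfolding sum_distrib_left
    by (subst sum.swap) (simp add: ip_def[of d u] sum_distrib_left mult_ac)
  also have "\<dots> = 0" using u(3) by simp
  finally have "\<forall>i<m. ip d u (Q (Suc i)) = 0"
    by (simp add: sum_nonneg_eq_0_iff)
  then show ?thesis using u unfolding degenerate_def by blast
qed

lemma same_rho_Ogrp:
  assumes P: "P \<in> V d" and Q: "Q \<in> V d" and rho: "rho d P = rho d Q"
  shows "\<exists>A\<in>Ogrp d. Q = (\<lambda>i. mact d A (P i))"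
proof -
  have "ip d (P (Suc i)) (P (Suc j)) = ip d (Q (Suc i)) (Q (Suc j))" if "i < m" "j < m" for i j
    using gram_rho[OF P that] gram_rho[OF Q that] rho by simp
  then obtain A where A: "A \<in> Ogrp d" "\<forall>i<m. mact d A (P (Suc i)) = Q (Suc i)"
    using Gram_eq_imp_Ogrp[of m "\<lambda>i. P (Suc i)" d "\<lambda>i. Q (Suc i)"] V_Rvec[OF P] V_Rvec[OF Q] by metis
  have z: "mact d A (\<lambda>_. 0) = (\<lambda>_. 0)" by (simp add: mact_def fun_eq_iff)
  have "Q = (\<lambda>i. mact d A (P i))"
    by (rule polygon_eqI) (use A V_0[OF P] V_0[OF Q] V_ge[OF P] V_ge[OF Q] z in auto)
  then show ?thesis using A by blast
qed

lemma mact_V: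
  assumes P: "P \<in> V d" and A: "A \<in> Ogrp d"
  shows "(\<lambda>i. mact d A (P i)) \<in> V d" "rho d (\<lambda>i. mact d A (P i)) = rho d P"
proof -
  have z: "mact d A (\<lambda>_. 0) = (\<lambda>_. 0)" by (simp add: mact_def fun_eq_iff)
  have sq: "sq d (mact d A x) (mact d A y) = sq d x y" for x y
    unfolding sq_def mact_diff[symmetric] by (rule ip_mact[OF A])
  show "(\<lambda>i. mact d A (P i)) \<in> V d"
    using P unfolding polyV_iff[OF l_pos] by (simp add: mact_Rvec z sq)
  show "rho d (\<lambda>i. mact d A (P i)) = rho d P"
    unfolding rho_def sq ..
qed

text \<open>If the determinant is -1, composing with a reflection that fixes \<open>Q\<close>
  corrects it to 1 without changing the image.\<close>

lemma orbit_relI: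
  assumes P: "P \<in> V d" and A: "A \<in> Ogrp d" and Q: "Q = (\<lambda>i. mact d A (P i))"
    and det: "mdet d A = 1 \<or> degenerate d Q"
  shows "(P, Q) \<in> orbit_rel n l d"
proof -
  have QV: "Q \<in> V d" using mact_V[OF P A] Q by simp
  have "\<exists>B\<in>SOgrp d. Q = (\<lambda>i. mact d B (P i))"
  proof (cases "mdet d A = 1")
    case True
    then show ?thesis using A Q by (auto simp: SOgrp_Ogrp)
  next
    case False
    then obtain u where u: "u \<in> Rvec d" "u \<noteq> (\<lambda>_. 0)" "\<And>i. i < m \<Longrightarrow> ip d u (Q (Suc i)) = 0"
      using det unfolding degenerate_def by blast
    define B where "B = mmul d (reflection d u) A"
    have "mdet d A = -1" using False mdet_Ogrp[OF A] by simp
    then have "mdet d B = 1" by (simp add: B_def mdet_mmul mdet_reflection[OF u(1,2)])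
    moreover have "B \<in> Ogrp d"
      unfolding B_def using ip_pos[OF u(1,2)] by (intro Ogrp_mmul reflection_Ogrp A) simp
    moreover have "mact d (reflection d u) (Q (Suc i)) = Q (Suc i)" if "i < m" for i
      using u(3)[OF that] V_Rvec[OF QV] by (auto simp: mact_reflection Rvec_def fun_eq_iff)
    moreover have "mact d (reflection d u) (\<lambda>_. 0) = (\<lambda>_. 0)" by (simp add: mact_def fun_eq_iff)
    ultimately have "Q = (\<lambda>i. mact d B (P i))"
      unfolding B_def mact_mmul using V_0[OF QV] V_ge[OF QV]
      by (intro polygon_eqI) (auto simp: Q dest: fun_cong)
    then show ?thesis using \<open>mdet d B = 1\<close> \<open>B \<in> Ogrp d\<close> by (auto simp: SOgrp_Ogrp)
  qed
  then show ?thesis using P QV by (auto simp: orbit_rel_def)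
qed

text \<open>An orthogonal matrix from \<open>P\<close> to \<open>Q\<close> exists and multiplies
  \<open>gdet d R\<close> by its determinant; agreement of signs excludes -1.\<close>

lemma orbit_rel_gdet:
  assumes P: "P \<in> V d" and Q: "Q \<in> V d" and rho: "rho d P = rho d Q"
    and "0 < gdet d R P * gdet d R Q"
  shows "(P, Q) \<in> orbit_rel n l d"
proof -
  obtain A where A: "A \<in> Ogrp d" "Q = (\<lambda>i. mact d A (P i))"
    using same_rho_Ogrp[OF P Q rho] by blast
  have "mdet d A \<noteq> -1"
    using assms(4) gdet_mact[of d R A P] A(2) by (auto simp: zero_less_mult_iff)
  then have "mdet d A = 1" using mdet_Ogrp[OF A(1)] by blast
  then show ?thesis using orbit_relI[OF P A] by blast
qed

lemma orbit_rel_degenerate: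
  assumes P: "P \<in> V d" and Q: "Q \<in> V d" and rho: "rho d P = rho d Q" and "degenerate d Q"
  shows "(P, Q) \<in> orbit_rel n l d"
  using same_rho_Ogrp[OF P Q rho] orbit_relI[OF P] assms(4) by blast

text \<open>The Gram data and all \<open>gdet d R\<close> form a complete set of continuous
  invariants: \<open>R = Q\<close> decides the orientation unless \<open>Q\<close> is degenerate.
  The orbit relation is thereby an equivalence, and these functions descend to the quotient.\<close>

lemma orbit_rel_iff:
  "(P, Q) \<in> orbit_rel n l d \<longleftrightarrow>
    P \<in> V d \<and> Q \<in> V d \<and> rho d P = rho d Q \<and> (\<forall>R. gdet d R P = gdet d R Q)"
proof
  assume "(P, Q) \<in> orbit_rel n l d"
  then show "P \<in> V d \<and> Q \<in> V d \<and> rho d P = rho d Q \<and> (\<forall>R. gdet d R P = gdet d R Q)"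
    by (auto simp: orbit_rel_def SOgrp_Ogrp mact_V gdet_mact)
next
  assume *: "P \<in> V d \<and> Q \<in> V d \<and> rho d P = rho d Q \<and> (\<forall>R. gdet d R P = gdet d R Q)"
  show "(P, Q) \<in> orbit_rel n l d"
  proof (cases "gdet d Q Q = 0")
    case True
    then show ?thesis using * gdet_self_eq_0 orbit_rel_degenerate by blast
  next
    case False
    then have "0 < gdet d Q P * gdet d Q Q" using * by (simp add: zero_less_mult_iff) linarith
    then show ?thesis using * orbit_rel_gdet by blast
  qed
qed

lemma equiv_orbit_rel: "equiv (V d) (orbit_rel n l d)"
  by (intro equivI refl_onI symI transI) (auto simp: orbit_rel_iff)

section \<open>The quotient map onto the moduli space\<close>

definition cls :: "nat \<Rightarrow> (nat \<Rightarrow> nat \<Rightarrow> real) \<Rightarrow> (nat \<Rightarrow> nat \<Rightarrow> real) set" where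
  "cls d P = orbit_rel n l d `` {P}"

lemma quotient_map_cls: "quotient_map (top_of_set (V d)) (polyM n l d) (cls d)"
  using quotient_map_quotient_topology[of "top_of_set (V d)" "orbit_rel n l d"] equiv_orbit_rel
  by (simp add: polyM_def polyV_top_def cls_def[abs_def])

lemma topspace_polyM: "topspace (polyM n l d) = cls d ` V d"
  using quotient_map_cls[of d] by (simp add: quotient_map_def)

lemma cls_eq_iff:
  assumes "P \<in> V d" "Q \<in> V d"
  shows "cls d P = cls d Q \<longleftrightarrow> (P, Q) \<in> orbit_rel n l d"
  unfolding cls_def using eq_equiv_class_iff[OF equiv_orbit_rel] assms by blast

lemma polyM_lift:
  fixes f :: "_ \<Rightarrow> 'a::topological_space"
  assumes "continuous_on (V d) f" "\<And>P Q. (P, Q) \<in> orbit_rel n l d \<Longrightarrow> f P = f Q"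
  obtains F where "continuous_map (polyM n l d) euclidean F"
    "\<And>P. P \<in> V d \<Longrightarrow> F (cls d P) = f P"
proof -
  have cont: "continuous_map (top_of_set (V d)) euclidean f" using assms(1) by simp
  show ?thesis
  proof (rule quotient_map_lift_exists[OF quotient_map_cls cont])
    fix P Q assume "P \<in> topspace (top_of_set (V d))" "Q \<in> topspace (top_of_set (V d))" "cls d P = cls d Q"
    then show "f P = f Q" by (intro assms(2)) (simp add: cls_eq_iff)
  next
    fix F :: "_ \<Rightarrow> 'a"
    assume "continuous_map (polyM n l d) euclidean F"
      and "\<And>P. P \<in> topspace (top_of_set (V d)) \<Longrightarrow> F (cls d P) = f P"
    then show ?thesis by (intro that[of F]) auto
  qed
qed

lemma degenerate_high:
  assumes "m < d"
  shows "degenerate d P"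
  using underdetermined_kernel[OF assms, of "\<lambda>i. P (Suc i)"]
  by (simp add: degenerate_def ip_def mult.commute)

lemma polyM_homeomorphic_K:
  assumes "n \<le> d"
  shows "polyM n l d homeomorphic_space top_of_set K"
proof -
  have d: "m < d" using assms n_Suc by simp
  then have "quotient_map (top_of_set (V d)) (top_of_set K) (rho d)"
    using compact_imp_quotient_map[OF compact_V continuous_on_rho] rho_image by (metis less_imp_le)
  moreover have "cls d P = cls d Q \<longleftrightarrow> rho d P = rho d Q" if "P \<in> V d" "Q \<in> V d" for P Q
    unfolding cls_eq_iff[OF that]
    using orbit_rel_degenerate[OF that _ degenerate_high[OF d]] orbit_rel_iff[of P Q d] by blast
  ultimately obtain h where "homeomorphic_map (polyM n l d) (top_of_set K) h"
    using quotient_maps_same_fibres_homeomorphic[OF quotient_map_cls] by (metis topspace_euclidean_subtopology)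
  then show ?thesis by (rule homeomorphic_map_imp_homeomorphic_space)
qed

section \<open>Boundedness of K and a point in its interior\<close>

lemma compact_K: "compact K"
  using compact_continuous_image[OF continuous_on_rho[of "V m" m] compact_V[of m]] rho_image[of m]
  by simp

lemma generic_exists:
  obtains P where "P \<in> V m" "\<And>z. z \<in> Rvec m \<Longrightarrow> z \<noteq> (\<lambda>_. 0) \<Longrightarrow> comb P z \<noteq> (\<lambda>_. 0)"
proof -
  obtain P where P: "generic_polygon n l P"
    using generic_polygon_exists[OF n3 lC] by blast
  have "comb P z \<noteq> (\<lambda>_. 0)" if z: "z \<in> Rvec m" "z \<noteq> (\<lambda>_. 0)" for z
  proof
    assume c: "comb P z = (\<lambda>_. 0)"
    have range: "{1..<n} = {Suc 0..<Suc m}" using n_Suc by simp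
    have sum: "(\<Sum>i\<in>{1..<n}. z (i - 1) * P i k) = comb P z k" for k
      unfolding range sum.atLeast_Suc_lessThan_Suc_shift by (simp add: comb_def lessThan_atLeast0)
    have imp: "(\<forall>k. (\<Sum>i\<in>{1..<n}. w i * P i k) = 0) \<Longrightarrow> i \<in> {1..<n} \<Longrightarrow> w i = 0" for w i
      using P unfolding generic_polygon_def by blast
    have zz: "z (i - 1) = 0" if "i \<in> {1..<n}" for i
      by (rule imp[of "\<lambda>i. z (i - 1)"]) (use that in \<open>simp_all add: sum c del: One_nat_def\<close>)
    have "z k = 0" for k
      using zz[of "Suc k"] z(1) n_Suc by (cases "k < m") (auto simp: Rvec_def)
    then show False using z(2) by auto
  qed
  moreover have "P \<in> V m" using P by (simp add: generic_polygon_def m_def)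
  ultimately show ?thesis using that by blast
qed

lemma quad_pos_iff:
  assumes "P \<in> V d"
  shows "0 < quad (rho d P) z \<longleftrightarrow> comb P z \<noteq> (\<lambda>_. 0)"
  using ip_nonneg[of d "comb P z"] ip_eq_0_iff[OF comb_Rvec[OF assms], of z]
  by (auto simp: quad_rho[OF assms])

text \<open>Otherwise the whole ray from \<open>c\<close> in direction \<open>y\<close> would stay
  in K, against boundedness.\<close>

lemma lin_neg_exists:
  assumes c: "c \<in> Rvec D" "\<And>z. z \<in> Sph \<Longrightarrow> 0 < quad c z"
    and y: "y \<in> Rvec D" "y \<noteq> (\<lambda>_. 0)"
  shows "\<exists>z\<in>Sph. (\<Sum>k<D. y k * lin k z) < 0"
proof (rule ccontr)
  assume "\<not> ?thesis"
  then have nn: "0 \<le> (\<Sum>k<D. y k * lin k z)" if "z \<in> Sph" for z using that by force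
  obtain k where k: "y k \<noteq> 0" using y by auto
  have "compact ((\<lambda>x. x k) ` K)"
    by (intro compact_continuous_image continuous_intros compact_K)
  then have "bounded ((\<lambda>x. x k) ` K)" by (rule compact_imp_bounded)
  then obtain C where C: "\<And>x. x \<in> K \<Longrightarrow> \<bar>x k\<bar> \<le> C"
    by (auto simp: bounded_iff)
  \<comment> \<open>Large enough that coordinate \<open>k\<close> of \<open>c + t y\<close> exceeds
    the bound \<open>C\<close> in absolute value.\<close>
  define t where "t = (\<bar>C\<bar> + \<bar>c k\<bar> + 1) / \<bar>y k\<bar>"
  have t: "0 \<le> t" "t * \<bar>y k\<bar> = \<bar>C\<bar> + \<bar>c k\<bar> + 1" using k by (simp_all add: t_def)
  have "(\<lambda>k. c k + t * y k) \<in> K"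
  proof -
    have "0 \<le> quad (\<lambda>k. c k + t * y k) z" if "z \<in> Sph" for z
    proof -
      have "(\<Sum>k<D. t * y k * lin k z) = t * (\<Sum>k<D. y k * lin k z)"
        by (simp add: sum_distrib_left mult.assoc)
      then show ?thesis
        using c(2)[OF that] nn[OF that] t(1) by (simp add: quad_add)
    qed
    then show ?thesis using c(1) y(1) by (auto simp: K_def Rvec_def)
  qed
  then have "\<bar>c k + t * y k\<bar> \<le> C" by (rule C)
  moreover have "\<bar>t * y k\<bar> = \<bar>C\<bar> + \<bar>c k\<bar> + 1" using t by (simp add: abs_mult)
  ultimately show False by linarith
qed

lemma continuous_on_quad: "continuous_on S (quad x)"
  unfolding quad_def by (intro continuous_intros)

lemma continuous_on_lin: "continuous_on S (lin k)"
  unfolding lin_def by (intro continuous_intros) auto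

end

section \<open>Low dimensions\<close>

context polygon_space
begin

text \<open>Within \<open>Rvec D\<close> this is the interior of K, as \<open>openin_posdef\<close>
  and \<open>open_subset_K_posdef\<close> show together.\<close>

definition posdef :: "(nat \<Rightarrow> real) \<Rightarrow> bool" where
  "posdef x \<longleftrightarrow> (\<forall>z\<in>Sph. 0 < quad x z)"

lemma posdef_in_K: "x \<in> Rvec D \<Longrightarrow> posdef x \<Longrightarrow> x \<in> K"
  by (auto simp: K_def posdef_def less_imp_le)

lemma not_posdef_iff:
  assumes "P \<in> V d"
  shows "\<not> posdef (rho d P) \<longleftrightarrow> (\<exists>z\<in>Rvec m. z \<noteq> (\<lambda>_. 0) \<and> comb P z = (\<lambda>_. 0))"
proof
  assume "\<not> posdef (rho d P)"
  then obtain z where "z \<in> Sph" "comb P z = (\<lambda>_. 0)"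
    using quad_pos_iff[OF assms] by (auto simp: posdef_def)
  then show "\<exists>z\<in>Rvec m. z \<noteq> (\<lambda>_. 0) \<and> comb P z = (\<lambda>_. 0)"
    using Sph_nonzero by (auto simp: Sph_def)
next
  assume "\<exists>z\<in>Rvec m. z \<noteq> (\<lambda>_. 0) \<and> comb P z = (\<lambda>_. 0)"
  then obtain z where z: "z \<in> Rvec m" "z \<noteq> (\<lambda>_. 0)" "comb P z = (\<lambda>_. 0)" by blast
  have "comb P (\<lambda>k. z k / s) = (\<lambda>k. comb P z k / s)" for s
    by (simp add: comb_def sum_divide_distrib)
  then have "comb P (\<lambda>k. z k / sqrt (ip m z z)) = (\<lambda>_. 0)" using z(3) by simp
  then show "\<not> posdef (rho d P)"
    using normalize_Sph[OF z(1,2)] quad_pos_iff[OF assms] unfolding posdef_def by blast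
qed

lemma low_not_posdef:
  assumes "d < m" "P \<in> V d"
  shows "\<not> posdef (rho d P)"
proof -
  obtain z where z: "z \<in> Rvec m" "z \<noteq> (\<lambda>_. 0)" "\<And>k. k < d \<Longrightarrow> (\<Sum>i<m. P (Suc i) k * z i) = 0"
    using underdetermined_kernel[OF assms(1), of "\<lambda>k i. P (Suc i) k"] by blast
  have "comb P z k = 0" for k
    using z(3)[of k] V_Rvec[OF assms(2)]
    by (cases "k < d") (simp_all add: comb_def mult.commute Rvec_def)
  then have "comb P z = (\<lambda>_. 0)" by (simp add: fun_eq_iff)
  then show ?thesis using not_posdef_iff[OF assms(2)] z by blast
qed

lemma mdet_not_posdef:
  assumes P: "P \<in> V m"
  shows "mdet m (\<lambda>i k. P (Suc i) k) = 0 \<longleftrightarrow> \<not> posdef (rho m P)"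
proof -
  have "comb P z = (\<lambda>_. 0) \<longleftrightarrow> (\<forall>k<m. (\<Sum>i<m. P (Suc i) k * z i) = 0)" for z
    using comb_Rvec[OF P, of z]
    by (auto simp: comb_def fun_eq_iff Rvec_def mult.commute[of "P _ _"]) (metis not_less)
  then show ?thesis
    unfolding not_posdef_iff[OF P] mdet_transpose[of m "\<lambda>i k. P (Suc i) k", symmetric] mdet_eq_0_iff
    by simp
qed

text \<open>For d = m the matrix R^T P is a product of two square matrices, and the determinant of
  the second factor vanishes.\<close>

lemma gdet_not_posdef:
  assumes "P \<in> V m" "\<not> posdef (rho m P)"
  shows "gdet m R P = 0"
proof -
  have "gdet m R P = mdet m (mmul m (\<lambda>a i. R (Suc i) a) (\<lambda>i b. P (Suc i) b))"
    by (simp add: gdet_def mmul_def)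
  then show ?thesis
    using mdet_not_posdef[OF assms(1)] assms(2) by (simp add: mdet_mmul)
qed

lemma degenerate_not_posdef:
  assumes "P \<in> V m" "degenerate m P"
  shows "\<not> posdef (rho m P)"
proof -
  have "mdet m (\<lambda>i k. P (Suc i) k) = 0"
    using assms(2) unfolding mdet_eq_0_iff degenerate_def by (simp add: ip_def mult.commute)
  then show ?thesis using mdet_not_posdef[OF assms(1)] by simp
qed

text \<open>A kernel vector \<open>u\<close> of P^T Q gives a linear relation among the vertices of
  \<open>P\<close> with coefficients the inner products of \<open>u\<close> with those of
  \<open>Q\<close>. For a generic \<open>P\<close> they all vanish. Hence this one polygon serves
  both as center of the gauge and as orientation reference for all nondegenerate polygons.\<close>

lemma center_exists:
  obtains P where "P \<in> V m" "posdef (rho m P)" "\<forall>Q. gdet m P Q = 0 \<longrightarrow> degenerate m Q"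
proof -
  obtain P where P: "P \<in> V m" "\<And>z. z \<in> Rvec m \<Longrightarrow> z \<noteq> (\<lambda>_. 0) \<Longrightarrow> comb P z \<noteq> (\<lambda>_. 0)"
    using generic_exists by blast
  have "degenerate m Q" if Q: "gdet m P Q = 0" for Q
  proof -
    obtain u where u: "u \<in> Rvec m" "u \<noteq> (\<lambda>_. 0)"
        "\<And>a. a < m \<Longrightarrow> (\<Sum>i<m. ip m u (Q (Suc i)) * P (Suc i) a) = 0"
      using gdet_kernel[OF Q] by blast
    define z where "z = (\<lambda>i. if i < m then ip m u (Q (Suc i)) else 0)"
    have "comb P z k = (\<Sum>i<m. ip m u (Q (Suc i)) * P (Suc i) k)" for k
      unfolding comb_def by (rule sum.cong) (auto simp: z_def)
    then have "comb P z k = 0" for k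
      using u(3) comb_Rvec[OF P(1), of z] by (cases "k < m") (auto simp: Rvec_def)
    then have "comb P z = (\<lambda>_. 0)" by (simp add: fun_eq_iff)
    moreover have "z \<in> Rvec m" by (simp add: z_def Rvec_def)
    ultimately have "z = (\<lambda>_. 0)" using P(2) by blast
    then have "ip m u (Q (Suc i)) = 0" if "i < m" for i
      using that by (metis z_def)
    then show ?thesis using u unfolding degenerate_def by blast
  qed
  moreover have "posdef (rho m P)" using not_posdef_iff[OF P(1)] P(2) by blast
  ultimately show ?thesis using that P(1) by blast
qed

text \<open>\<open>g\<close> is the Minkowski functional of K about \<open>c\<close>: its unit ball
  is K, and its open unit ball the interior.\<close>

definition gauge_at :: "(nat \<Rightarrow> real) \<Rightarrow> ((nat \<Rightarrow> real) \<Rightarrow> real) \<Rightarrow> bool" where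
  "gauge_at c g \<longleftrightarrow> continuous_on UNIV g \<and> (\<forall>t\<ge>0. \<forall>y. g (\<lambda>k. t * y k) = t * g y) \<and>
    (\<forall>y\<in>Rvec D. y \<noteq> (\<lambda>_. 0) \<longrightarrow> 0 < g y) \<and> (\<forall>y\<in>Rvec D. g y \<le> 1 \<longleftrightarrow> (\<lambda>k. c k + y k) \<in> K) \<and>
    (\<forall>y. g y < 1 \<longleftrightarrow> posdef (\<lambda>k. c k + y k))"

lemma gauge_atD:
  assumes "gauge_at c g"
  shows "continuous_on UNIV g"
    "\<And>t y. 0 \<le> t \<Longrightarrow> g (\<lambda>k. t * y k) = t * g y"
    "\<And>y. y \<in> Rvec D \<Longrightarrow> y \<noteq> (\<lambda>_. 0) \<Longrightarrow> 0 < g y"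
    "\<And>y. y \<in> Rvec D \<Longrightarrow> g y \<le> 1 \<longleftrightarrow> (\<lambda>k. c k + y k) \<in> K"
    "\<And>y. g y < 1 \<longleftrightarrow> posdef (\<lambda>k. c k + y k)"
  using assms unfolding gauge_at_def by blast+

lemma gauge_at_exists:
  assumes "c \<in> Rvec D" "posdef c"
  shows "\<exists>g. gauge_at c g"
proof -
  have c: "0 < quad c z" if "z \<in> Sph" for z using assms(2) that by (simp add: posdef_def)
  show ?thesis
  proof (rule gauge_exists[OF compact_Sph Sph_nonempty continuous_on_quad continuous_on_lin c lin_neg_exists[OF assms(1) c]])
    fix g :: "(nat \<Rightarrow> real) \<Rightarrow> real"
    assume g: "continuous_on UNIV g" "\<And>t y. 0 \<le> t \<Longrightarrow> g (\<lambda>k. t * y k) = t * g y"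
      "\<And>y. y \<in> Rvec D \<Longrightarrow> y \<noteq> (\<lambda>_. 0) \<Longrightarrow> 0 < g y"
      "\<And>y. g y \<le> 1 \<longleftrightarrow> (\<forall>z\<in>Sph. 0 \<le> quad c z + (\<Sum>k<D. y k * lin k z))"
      "\<And>y. g y < 1 \<longleftrightarrow> (\<forall>z\<in>Sph. 0 < quad c z + (\<Sum>k<D. y k * lin k z))"
    have "g y \<le> 1 \<longleftrightarrow> (\<lambda>k. c k + y k) \<in> K" if "y \<in> Rvec D" for y
      using assms(1) that by (simp add: g(4) K_def quad_add Rvec_def)
    moreover have "g y < 1 \<longleftrightarrow> posdef (\<lambda>k. c k + y k)" for y
      by (simp add: g(5) posdef_def quad_add)
    ultimately show ?thesis using g(1,2,3) unfolding gauge_at_def by blast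
  qed
qed

lemma continuous_on_shift: "continuous_on S (\<lambda>x :: nat \<Rightarrow> real. \<lambda>k. x k - c k)"
  by (rule continuous_on_coordinatewise_then_product) (intro continuous_intros)

text \<open>Positive definiteness is the strict inequality \<open>g < 1\<close> for the continuous
  gauge about a fixed interior point.\<close>

lemma openin_posdef: "openin (top_of_set (Rvec D)) {x \<in> Rvec D. posdef x}"
proof -
  obtain P where "posdef (rho m P)" by (rule center_exists)
  then obtain g where "gauge_at (rho m P) g"
    using gauge_at_exists[OF rho_Rvec] by blast
  note g = gauge_atD(1,5)[OF this]
  have "continuous_on UNIV (\<lambda>x. g (\<lambda>k. x k - rho m P k))"
    by (rule continuous_on_compose2[OF g(1) continuous_on_shift]) simp
  then have "open {x. g (\<lambda>k. x k - rho m P k) < 1}"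
    by (intro open_Collect_less continuous_on_const)
  moreover have "g (\<lambda>k. x k - rho m P k) < 1 \<longleftrightarrow> posdef x" for x by (simp add: g(2))
  ultimately have "open {x. posdef x}" by simp
  moreover have "{x \<in> Rvec D. posdef x} = Rvec D \<inter> {x. posdef x}" by auto
  ultimately show ?thesis by (simp add: openin_open_Int)
qed

text \<open>A point of K that is not positive definite has gauge at least 1; moving it slightly away
  from the center \<open>c\<close> raises the gauge above 1, yet openness of \<open>U\<close> keeps
  it in K.\<close>

lemma open_subset_K_posdef:
  assumes U: "openin (top_of_set (Rvec D)) U" "U \<subseteq> K" and x: "x \<in> U"
  shows "posdef x"
proof (rule ccontr)
  assume np: "\<not> posdef x"
  obtain P where P: "posdef (rho m P)" by (rule center_exists)
  define c where "c = rho m P"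
  have c: "c \<in> Rvec D" "posdef c" using P by (simp_all add: c_def rho_Rvec)
  obtain g where "gauge_at c g" using gauge_at_exists[OF c] by blast
  note g = gauge_atD(2,4,5)[OF this]
  define y where "y = (\<lambda>k. x k - c k)"
  have xR: "x \<in> Rvec D" using U x by (auto simp: K_def)
  then have y: "y \<in> Rvec D" using c by (simp add: y_def Rvec_def)
  have "\<not> g y < 1" using np g(3)[of y] by (simp add: y_def)
  define f where "f = (\<lambda>t :: real. \<lambda>k. c k + t * y k)"
  have "continuous_on UNIV f"
    unfolding f_def by (rule continuous_on_coordinatewise_then_product) (intro continuous_intros)
  moreover have fR: "f t \<in> Rvec D" for t using c y by (simp add: f_def Rvec_def)
  ultimately have "openin (top_of_set UNIV) (UNIV \<inter> f -` U)"
    using U(1) by (intro continuous_openin_preimage[where T = "Rvec D"]) auto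
  then have "open (f -` U)" by simp
  moreover have "f 1 = x" by (simp add: f_def y_def)
  ultimately obtain e where e: "0 < e" "ball 1 e \<subseteq> f -` U"
    using x unfolding open_contains_ball by (metis vimageI)
  define t where "t = 1 + e / 2"
  have "t \<in> ball 1 e" using e by (simp add: t_def dist_real_def)
  then have "f t \<in> K" using e U(2) by blast
  moreover have "(\<lambda>k. t * y k) \<in> Rvec D" using y by (simp add: Rvec_def)
  ultimately have "g (\<lambda>k. t * y k) \<le> 1" using g(2) by (simp add: f_def)
  then have "t * g y \<le> 1" using g(1)[of t y] e by (simp add: t_def)
  moreover have "t * 1 \<le> t * g y" using \<open>\<not> g y < 1\<close> e by (intro mult_left_mono) (auto simp: t_def)
  moreover have "1 < t" using e by (simp add: t_def)
  ultimately show False by linarith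
qed

text \<open>On an open subset of the positive definite locus the composition of a homeomorphism from K
  with the Gram map would be an injection into the boundary of K: where some polygon spans, its
  determinants with the nearby ones fix the orientation; where none does, the Gram matrix
  already determines the orbit.\<close>
lemma not_homeomorphic_low:
  assumes d: "d < m"
  shows "\<not> top_of_set K homeomorphic_space polyM n l d"
proof
  assume "top_of_set K homeomorphic_space polyM n l d"
  then obtain h where h: "homeomorphic_map (top_of_set K) (polyM n l d) h"
    unfolding homeomorphic_space by blast
  then have hc: "continuous_map (top_of_set K) (polyM n l d) h" and hi: "inj_on h K"
    using homeomorphic_imp_continuous_map homeomorphic_imp_injective_map[OF h] by auto
  have "\<exists>P\<in>V d. h x = cls d P" if "x \<in> K" for x
    using continuous_map_image_subset_topspace[OF hc] that by (auto simp: topspace_polyM)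
  \<comment> \<open>Representatives are chosen without any continuity. Continuity comes only from
    the invariants that descend to the quotient, namely \<open>r\<close> here and \<open>s\<close>
    below.\<close>
  then obtain p where p: "\<And>x. x \<in> K \<Longrightarrow> p x \<in> V d" "\<And>x. x \<in> K \<Longrightarrow> h x = cls d (p x)"
    by metis
  obtain r where r: "continuous_map (polyM n l d) euclidean r" "\<And>P. P \<in> V d \<Longrightarrow> r (cls d P) = rho d P"
    by (rule polyM_lift[of d "rho d", OF continuous_on_rho]) (auto simp: orbit_rel_iff)
  have rh: "r (h x) = rho d (p x)" if "x \<in> K" for x using p r that by simp
  have "continuous_map (top_of_set K) euclidean (r \<circ> h)" using hc r(1) by (rule continuous_map_compose)
  then have rhc: "continuous_on K (r \<circ> h)" by simp
  have eqI: "x = y" if "x \<in> K" "y \<in> K" "(p x, p y) \<in> orbit_rel n l d" for x y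
    using that p cls_eq_iff hi by (metis inj_onD)
  define U where "U = {x \<in> Rvec D. posdef x}"
  have U: "openin (top_of_set (Rvec D)) U" "U \<subseteq> K" "U \<noteq> {}"
    using openin_posdef posdef_in_K center_exists rho_Rvec by (auto simp: U_def) metis
  have "\<exists>W. openin (top_of_set (Rvec D)) W \<and> W \<subseteq> U \<and> W \<noteq> {} \<and> inj_on (r \<circ> h) W"
  proof (cases "\<exists>x\<in>U. \<not> degenerate d (p x)")
    case True
    then obtain x0 where x0: "x0 \<in> U" "\<not> degenerate d (p x0)" by blast
    define R where "R = p x0"
    define a where "a = gdet d R R"
    have a: "a \<noteq> 0" using x0 gdet_self_eq_0 by (auto simp: a_def R_def)
    obtain s where s: "continuous_map (polyM n l d) euclidean s" "\<And>P. P \<in> V d \<Longrightarrow> s (cls d P) = gdet d R P"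
      by (rule polyM_lift[of d "gdet d R", OF continuous_on_gdet]) (auto simp: orbit_rel_iff)
    have sh: "s (h x) = gdet d R (p x)" if "x \<in> K" for x using p s that by simp
    have "continuous_map (top_of_set K) euclidean (s \<circ> h)" using hc s(1) by (rule continuous_map_compose)
    then have "continuous_on U (\<lambda>x. s (h x) * a)"
      using U(2) by (auto simp: o_def intro!: continuous_intros elim: continuous_on_subset)
    then have "openin (top_of_set U) (U \<inter> (\<lambda>x. s (h x) * a) -` {0<..})"
      by (rule continuous_openin_preimage_gen) simp
    \<comment> \<open>On \<open>W\<close> every representative has the orientation sign of the
      reference \<open>R\<close>, so equal Gram data force equal orbits.\<close>
    define W where "W = U \<inter> (\<lambda>x. s (h x) * a) -` {0<..}"
    have "openin (top_of_set (Rvec D)) W"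
      unfolding W_def using \<open>openin (top_of_set U) _\<close> U(1) by (rule openin_trans)
    moreover have "x0 \<in> W"
      using x0 U(2) a sh[of x0] by (auto simp: W_def a_def R_def zero_less_mult_iff)
    moreover have "inj_on (r \<circ> h) W"
    proof (rule inj_onI)
      fix x y assume x: "x \<in> W" and y: "y \<in> W" and eq: "(r \<circ> h) x = (r \<circ> h) y"
      have K: "x \<in> K" "y \<in> K" using x y U(2) by (auto simp: W_def)
      have "0 < gdet d R (p x) * a" "0 < gdet d R (p y) * a"
        using x y sh K by (auto simp: W_def)
      then have "0 < gdet d R (p x) * gdet d R (p y)"
        by (auto simp: zero_less_mult_iff)
      moreover have "rho d (p x) = rho d (p y)" using eq rh K by simp
      ultimately show "x = y" using orbit_rel_gdet eqI K p(1) by blast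
    qed
    ultimately show ?thesis unfolding W_def by blast
  next
    case False
    have "inj_on (r \<circ> h) U"
    proof (rule inj_onI)
      fix x y assume x: "x \<in> U" and y: "y \<in> U" and eq: "(r \<circ> h) x = (r \<circ> h) y"
      have K: "x \<in> K" "y \<in> K" using x y U(2) by auto
      moreover have "rho d (p x) = rho d (p y)" using eq rh K by simp
      ultimately show "x = y" using orbit_rel_degenerate eqI p(1) False y by blast
    qed
    then show ?thesis using U by blast
  qed
  then obtain W where W: "openin (top_of_set (Rvec D)) W" "W \<subseteq> K" "W \<noteq> {}" "inj_on (r \<circ> h) W"
    using U(2) by blast
  have WK: "(r \<circ> h) ` W \<subseteq> K" using rh p(1) rho_in_K W(2) by auto
  then have "(r \<circ> h) ` W \<subseteq> Rvec D" by (auto simp: K_def)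
  then have "openin (top_of_set (Rvec D)) ((r \<circ> h) ` W)"
    using W continuous_on_subset[OF rhc W(2)] invariance_of_domain_Rvec by blast
  moreover obtain x where x: "x \<in> W" using W(3) by blast
  \<comment> \<open>Contradiction: these are Gram data of polygons in R^d with d < m, whose m
    vertices are linearly dependent.\<close>
  ultimately have "posdef ((r \<circ> h) x)"
    using open_subset_K_posdef WK by blast
  then show False
    using low_not_posdef[OF d p(1)] rh x W(2) by auto
qed

end

section \<open>The critical dimension\<close>

context polygon_space
begin

text \<open>A vanishing \<open>gdet m R\<close> means degeneracy, where orientation is irrelevant,
  so closed half-spaces of orientation can be used. The sign \<open>s\<close> treats both halves at
  once.\<close>

lemma cls_eq_same_sign:
  assumes P: "P \<in> V m" and Q: "Q \<in> V m" and rho: "rho m P = rho m Q"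
    and R: "\<forall>Q. gdet m R Q = 0 \<longrightarrow> degenerate m Q"
    and s: "0 \<le> s * gdet m R P" "0 \<le> s * gdet m R Q" "s = 1 \<or> s = -1"
  shows "cls m P = cls m Q"
proof -
  have "gdet m R P = 0 \<or> gdet m R Q = 0 \<or> 0 < gdet m R P * gdet m R Q"
    using s by (auto simp: zero_less_mult_iff)
  then consider "gdet m R P = 0" | "gdet m R Q = 0" | "0 < gdet m R P * gdet m R Q" by blast
  then show ?thesis
  proof cases
    case 1
    then show ?thesis using R orbit_rel_degenerate[OF Q P rho[symmetric]] cls_eq_iff[OF Q P] by simp
  next
    case 2
    then show ?thesis using R orbit_rel_degenerate[OF P Q rho] cls_eq_iff[OF P Q] by simp
  next
    case 3
    then show ?thesis using orbit_rel_gdet[OF P Q rho] cls_eq_iff[OF P Q] by simp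
  qed
qed

lemma oriented_realize:
  assumes x: "x \<in> K" and s: "s = 1 \<or> s = (-1 :: real)"
  shows "\<exists>Q\<in>V m. 0 \<le> s * gdet m R Q \<and> rho m Q = x"
proof -
  obtain P where P: "P \<in> V m" "rho m P = x" using K_realize[OF x] by blast
  \<comment> \<open>Any nonzero vector would do: a reflection reverses the sign of
    \<open>gdet\<close> and keeps the Gram data.\<close>
  define u where "u = (\<lambda>k :: nat. if k = 0 then 1 else 0 :: real)"
  have "u \<in> Rvec m" using m2 by (auto simp: u_def Rvec_def)
  moreover have "u \<noteq> (\<lambda>_. 0)" by (auto simp: u_def fun_eq_iff)
  ultimately have A: "reflection m u \<in> Ogrp m" "mdet m (reflection m u) = -1"
    using ip_pos[of u m] reflection_Ogrp[of m u] mdet_reflection[of u m] by auto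
  have "0 \<le> s * gdet m R P \<or> 0 \<le> s * gdet m R (\<lambda>i. mact m (reflection m u) (P i))"
    by (simp add: gdet_mact A(2)) linarith
  then show ?thesis using P mact_V[OF P(1) A(1)] by blast
qed

text \<open>The polygons of one closed orientation form a compact set \<open>H\<close> that the Gram
  map sends onto K with fibres inside single orbits. The class map on \<open>H\<close> thus descends
  to a continuous section over K.\<close>

lemma oriented_section:
  assumes R: "\<forall>Q. gdet m R Q = 0 \<longrightarrow> degenerate m Q" and s: "s = 1 \<or> s = (-1 :: real)"
  shows "\<exists>j. continuous_map (top_of_set K) (polyM n l m) j \<and>
    (\<forall>Q\<in>V m. 0 \<le> s * gdet m R Q \<longrightarrow> j (rho m Q) = cls m Q)"
proof -
  define H where "H = V m \<inter> {Q. 0 \<le> s * gdet m R Q}"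
  have "closed {Q. 0 \<le> s * gdet m R Q}"
    by (intro closed_Collect_le continuous_intros continuous_on_gdet)
  then have "compact H" unfolding H_def by (intro compact_Int_closed compact_V)
  moreover have "rho m ` H = K"
  proof
    show "rho m ` H \<subseteq> K" using rho_in_K by (auto simp: H_def)
    show "K \<subseteq> rho m ` H"
    proof
      fix x assume "x \<in> K"
      then obtain Q where "Q \<in> V m" "0 \<le> s * gdet m R Q" "rho m Q = x"
        using oriented_realize[OF _ s] by blast
      then show "x \<in> rho m ` H" by (auto simp: H_def)
    qed
  qed
  ultimately have q: "quotient_map (top_of_set H) (top_of_set K) (rho m)"
    using compact_imp_quotient_map[OF _ continuous_on_rho[of H m]] by simp
  have c: "continuous_map (top_of_set H) (polyM n l m) (cls m)"
    by (rule continuous_map_from_subtopology_mono[OF quotient_imp_continuous_map[OF quotient_map_cls]])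
      (simp add: H_def)
  show ?thesis
  proof (rule quotient_map_lift_exists[OF q c])
    fix P Q assume "P \<in> topspace (top_of_set H)" "Q \<in> topspace (top_of_set H)" "rho m P = rho m Q"
    then show "cls m P = cls m Q"
      using s by (intro cls_eq_same_sign[OF _ _ _ R]) (auto simp: H_def)
  next
    fix j assume "continuous_map (top_of_set K) (polyM n l m) j"
      and "\<And>Q. Q \<in> topspace (top_of_set H) \<Longrightarrow> j (rho m Q) = cls m Q"
    then show ?thesis by (intro exI[of _ j]) (auto simp: H_def)
  qed
qed

text \<open>For d = n - 1 the moduli space is the double of K, two copies jp, jm of K glued along the
  boundary; inverting the second copy in the gauge g parametrizes the double minus one point by
  R^D. By invariance of domain a homeomorphism onto K would map it into the interior of K,
  although K has more than one boundary point.\<close>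
lemma not_homeomorphic_double: "\<not> polyM n l m homeomorphic_space top_of_set K"
proof
  assume "polyM n l m homeomorphic_space top_of_set K"
  then obtain h where h: "homeomorphic_map (polyM n l m) (top_of_set K) h"
    unfolding homeomorphic_space by blast
  have hc: "continuous_map (polyM n l m) (top_of_set K) h"
    using h by (rule homeomorphic_imp_continuous_map)
  have hi: "inj_on h (cls m ` V m)" and hs: "h ` cls m ` V m = K"
    using homeomorphic_imp_injective_map[OF h] homeomorphic_imp_surjective_map[OF h]
    by (simp_all add: topspace_polyM)
  obtain R where R: "R \<in> V m" "posdef (rho m R)" "\<forall>Q. gdet m R Q = 0 \<longrightarrow> degenerate m Q"
    by (rule center_exists)
  define c where "c = rho m R"
  have c: "c \<in> Rvec D" "posdef c" using R by (simp_all add: c_def rho_Rvec)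
  have cK: "c \<in> K" using c posdef_in_K by blast
  obtain g where "gauge_at c g" using gauge_at_exists[OF c] by blast
  note g = gauge_atD[OF this]
  define S where "S = gdet m R"
  \<comment> \<open>The orientation function vanishes exactly over the boundary of K, where the two
    sections will agree.\<close>
  have S0: "S Q = 0 \<longleftrightarrow> \<not> posdef (rho m Q)" if "Q \<in> V m" for Q
    using gdet_not_posdef[OF that] degenerate_not_posdef[OF that] R(3) by (auto simp: S_def)
  obtain jp where jp: "continuous_map (top_of_set K) (polyM n l m) jp"
      "\<And>Q. Q \<in> V m \<Longrightarrow> 0 \<le> S Q \<Longrightarrow> jp (rho m Q) = cls m Q"
    using oriented_section[OF R(3), where s = 1] by (auto simp: S_def)
  obtain jm where jm: "continuous_map (top_of_set K) (polyM n l m) jm"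
      "\<And>Q. Q \<in> V m \<Longrightarrow> S Q \<le> 0 \<Longrightarrow> jm (rho m Q) = cls m Q"
    using oriented_section[OF R(3), where s = "-1"] by (auto simp: S_def)
  have exp: "\<exists>Q\<in>V m. 0 \<le> S Q \<and> rho m Q = x" and exm: "\<exists>Q\<in>V m. S Q \<le> 0 \<and> rho m Q = x" if "x \<in> K" for x
    using oriented_realize[OF that, of 1 R] oriented_realize[OF that, of "-1" R] by (auto simp: S_def)
  have jpV: "jp x \<in> cls m ` V m" and jmV: "jm x \<in> cls m ` V m" if "x \<in> K" for x
    using exp[OF that] exm[OF that] jp(2) jm(2) by (metis imageI)+
  have cls_rho: "rho m P = rho m Q" "S P = S Q" if "P \<in> V m" "Q \<in> V m" "cls m P = cls m Q" for P Q
    using that by (simp_all add: cls_eq_iff orbit_rel_iff S_def)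
  have jp_inj: "x = y" if "x \<in> K" "y \<in> K" "jp x = jp y" for x y
    using that exp cls_rho(1) jp(2) by metis
  have jm_inj: "x = y" if "x \<in> K" "y \<in> K" "jm x = jm y" for x y
    using that exm cls_rho(1) jm(2) by metis
  have jp_jm: "x = y \<and> \<not> posdef x" if xy: "x \<in> K" "y \<in> K" "jp x = jm y" for x y
  proof -
    obtain P where P: "P \<in> V m" "0 \<le> S P" "rho m P = x" using exp xy by blast
    obtain Q where Q: "Q \<in> V m" "S Q \<le> 0" "rho m Q = y" using exm xy by blast
    have "cls m P = cls m Q" using jp(2)[OF P(1,2)] jm(2)[OF Q(1,2)] P Q xy by simp
    then have "rho m P = rho m Q" "S P = S Q" using cls_rho P Q by blast+
    then show ?thesis using S0[OF P(1)] P Q by auto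
  qed
  have glue: "jp x = jm x" if x: "x \<in> K" "\<not> posdef x" for x
  proof -
    obtain P where P: "P \<in> V m" "0 \<le> S P" "rho m P = x" using exp x by blast
    then show ?thesis using S0[OF P(1)] jp(2)[OF P(1)] jm(2)[OF P(1)] x(2) by simp
  qed
  define a where "a = (\<lambda>y :: nat \<Rightarrow> real. \<lambda>k. c k + y k)"
  \<comment> \<open>Inversion in the hypersurface \<open>g = 1\<close>: by homogeneity
    \<open>g (b y) = 1 / g y\<close>, so that hypersurface is fixed pointwise.\<close>
  define b where "b = (\<lambda>y. \<lambda>k. y k / (g y)\<^sup>2)"
  have a_eq: "a y = a z \<longleftrightarrow> y = z" for y z by (auto simp: a_def fun_eq_iff)
  have aR: "a y \<in> Rvec D" and bR: "b y \<in> Rvec D" if "y \<in> Rvec D" for y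
    using that c(1) by (auto simp: a_def b_def Rvec_def)
  have aK: "a y \<in> K \<longleftrightarrow> g y \<le> 1" if "y \<in> Rvec D" for y
    using g(4)[OF that] by (simp add: a_def)
  have a_pos: "posdef (a y) \<longleftrightarrow> g y < 1" for y using g(5)[of y] by (simp add: a_def)
  have gscale: "g (\<lambda>k. y k / t) = g y / t" if "0 \<le> t" for y t
    using g(2)[of "1 / t" y] that by simp
  have gb: "g (b y) = 1 / g y" if "g y \<noteq> 0" for y
    using that by (simp add: b_def gscale power2_eq_square)
  have bK: "a (b y) \<in> K" if "y \<in> Rvec D" "1 \<le> g y" for y
    using aK[OF bR[OF that(1)]] gb[of y] that(2) by simp
  have a_surj: "\<exists>y\<in>Rvec D. x = a y" if "x \<in> Rvec D" for x
    using that c(1) by (intro bexI[of _ "\<lambda>k. x k - c k"]) (auto simp: a_def Rvec_def)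
  have contg: "continuous_on T g" for T using g(1) by (rule continuous_on_subset) simp
  have conta: "continuous_on T a" for T
    unfolding a_def by (rule continuous_on_coordinatewise_then_product) (intro continuous_intros)
  have contb: "continuous_on {y \<in> Rvec D. 1 \<le> g y} b"
    unfolding b_def by (rule continuous_on_coordinatewise_then_product) (intro continuous_intros contg, auto)
  have contp: "continuous_on K (\<lambda>x. h (jp x))" and contm: "continuous_on K (\<lambda>x. h (jm x))"
    using continuous_map_compose[OF jp(1) hc] continuous_map_compose[OF jm(1) hc]
    by (simp_all add: o_def)
  \<comment> \<open>The first sheet fills \<open>g \<le> 1\<close>, the inverted second sheet the
    outside. The center of the second sheet corresponds to infinity and is the only point of the
    double left out.\<close>
  define F where "F = (\<lambda>y. if g y \<le> 1 then h (jp (a y)) else h (jm (a (b y))))"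
  have contF: "continuous_on (Rvec D) F"
    unfolding F_def
  proof (rule continuous_on_cases_le)
    show "continuous_on {y \<in> Rvec D. g y \<le> 1} (\<lambda>y. h (jp (a y)))"
      by (rule continuous_on_compose2[OF contp conta]) (auto simp: aK)
    have "continuous_on {y \<in> Rvec D. 1 \<le> g y} (\<lambda>y. a (b y))"
      by (rule continuous_on_compose2[OF conta contb order_refl])
    then show "continuous_on {y \<in> Rvec D. 1 \<le> g y} (\<lambda>y. h (jm (a (b y))))"
      by (rule continuous_on_compose2[OF contm]) (auto simp: bK)
    fix y assume y: "y \<in> Rvec D" "g y = 1"
    then have "b y = y" by (simp add: b_def)
    then show "h (jp (a y)) = h (jm (a (b y)))"
      using glue[of "a y"] aK[OF y(1)] a_pos[of y] y by simp
  qed (rule contg)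
  have h_eq: "x = y" if "x \<in> cls m ` V m" "y \<in> cls m ` V m" "h x = h y" for x y
    using hi that by (meson inj_onD)
  \<comment> \<open>The sheets meet only over the boundary, whereas \<open>g z > 1\<close> places
    \<open>b z\<close> strictly inside.\<close>
  have mixed: False if "y \<in> Rvec D" "z \<in> Rvec D" "g y \<le> 1" "1 < g z" "h (jp (a y)) = h (jm (a (b z)))" for y z
  proof -
    have K: "a y \<in> K" "a (b z) \<in> K" using that aK bK by auto
    have "jp (a y) = jm (a (b z))" using K jpV jmV h_eq that(5) by blast
    then have "\<not> posdef (a (b z))" using jp_jm[OF K] by auto
    moreover have "g (b z) < 1" using gb[of z] that(4) by simp
    ultimately show False by (simp add: a_pos)
  qed
  have injF: "inj_on F (Rvec D)"
  proof (rule inj_onI)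
    fix y z assume y: "y \<in> Rvec D" and z: "z \<in> Rvec D" and eq: "F y = F z"
    consider "g y \<le> 1" "g z \<le> 1" | "g y \<le> 1" "1 < g z" | "1 < g y" "g z \<le> 1" | "1 < g y" "1 < g z"
      by linarith
    then show "y = z"
    proof cases
      case 1
      then have K: "a y \<in> K" "a z \<in> K" using aK y z by auto
      then have "jp (a y) = jp (a z)" using eq 1 jpV by (intro h_eq) (auto simp: F_def)
      then show ?thesis using jp_inj[OF K] a_eq by blast
    next
      case 2
      then show ?thesis using mixed[OF y z] eq by (simp add: F_def)
    next
      case 3
      then show ?thesis using mixed[OF z y] eq by (simp add: F_def)
    next
      case 4
      then have K: "a (b y) \<in> K" "a (b z) \<in> K" using bK y z by auto
      then have "jm (a (b y)) = jm (a (b z))" using eq 4 jmV by (intro h_eq) (auto simp: F_def)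
      then have b: "b y = b z" using jm_inj[OF K] a_eq by blast
      then have "g y = g z" using gb[of y] gb[of z] 4 by simp
      then show ?thesis using b 4 by (auto simp: b_def fun_eq_iff)
    qed
  qed
  have FK: "F ` Rvec D \<subseteq> K"
    using hs jpV jmV aK bK by (auto simp: F_def)
  have "openin (top_of_set (Rvec D)) (F ` Rvec D)"
    using FK by (intro invariance_of_domain_Rvec contF injF) (auto simp: K_def)
  then have F_pos: "posdef x" if "x \<in> F ` Rvec D" for x
    using open_subset_K_posdef FK that by blast
  \<comment> \<open>The image of the omitted point: all of K except possibly \<open>k0\<close> lies
    in the image of \<open>F\<close>.\<close>
  define k0 where "k0 = h (jm c)"
  have F_surj: "x \<in> F ` Rvec D" if x: "x \<in> K" "x \<noteq> k0" for x
  proof -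
    obtain Q where Q: "Q \<in> V m" "x = h (cls m Q)" using x(1) hs by blast
    obtain y where y: "y \<in> Rvec D" "rho m Q = a y" using a_surj[OF rho_Rvec] by metis
    have yK: "g y \<le> 1" using rho_in_K[OF Q(1)] y aK by simp
    show ?thesis
    proof (cases "0 \<le> S Q")
      case True
      then have "x = F y" using jp(2)[OF Q(1)] Q y yK by (simp add: F_def)
      then show ?thesis using y by blast
    next
      case False
      then have jmQ: "jm (a y) = cls m Q" using jm(2)[OF Q(1)] y by simp
      have "posdef (a y)" using False S0[OF Q(1)] y by auto
      then have g1: "g y < 1" by (simp add: a_pos)
      have "y \<noteq> (\<lambda>_. 0)" using jmQ Q x(2) by (auto simp: k0_def a_def)
      then have g0: "0 < g y" using g(3) y by blast
      define z where "z = b y"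
      have gz: "g z = 1 / g y" using gb[of y] g0 by (simp add: z_def)
      have "z k = y k / (g y)\<^sup>2" for k by (simp add: z_def b_def)
      then have "b z = y" using g0 by (simp add: b_def gz power_divide)
      then have "F z = x" using gz g0 g1 jmQ Q by (simp add: F_def)
      then show ?thesis using bR[OF y(1)] by (auto simp: z_def)
    qed
  qed
  show False
  proof (cases "\<exists>y\<in>Rvec D. y \<noteq> (\<lambda>_. 0)")
    case True
    then obtain y where y: "y \<in> Rvec D" "y \<noteq> (\<lambda>_. 0)" by blast
    define y' where "y' = (\<lambda>k. - y k)"
    have y': "y' \<in> Rvec D" "y' \<noteq> (\<lambda>_. 0)" using y by (auto simp: y'_def Rvec_def fun_eq_iff)
    \<comment> \<open>Radial projection to \<open>g = 1\<close>. Boundary points are not positive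
      definite, hence not in the image of \<open>F\<close>, so all would equal \<open>k0\<close>;
      opposite directions yield two different ones.\<close>
    define e where "e = (\<lambda>y. \<lambda>k. y k / g y)"
    have e: "a (e y) = k0" if "y \<in> Rvec D" "y \<noteq> (\<lambda>_. 0)" for y
    proof (rule ccontr)
      assume ne: "a (e y) \<noteq> k0"
      have "0 < g y" using g(3) that by blast
      then have "g (e y) = 1" using gscale[of "g y" y] by (simp add: e_def)
      moreover have "e y \<in> Rvec D" using that by (simp add: e_def Rvec_def)
      ultimately show False
        using aK F_surj[OF _ ne] F_pos a_pos[of "e y"] by auto
    qed
    have "e y = e y'" using e[OF y] e[OF y'] a_eq by metis
    then have eq: "y k / g y = - y k / g y'" for k by (simp add: e_def y'_def fun_eq_iff)
    obtain k where k: "y k \<noteq> 0" using y(2) by auto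
    have "0 < g y" "0 < g y'" using g(3) y y' by blast+
    then have "y k * (g y + g y') = 0" using eq[of k] by (simp add: field_simps)
    then show False using k \<open>0 < g y\<close> \<open>0 < g y'\<close> by simp
  next
    \<comment> \<open>The case \<open>D = 0\<close>: K is the single point \<open>c\<close>, while
      its two lifts \<open>jp c\<close> and \<open>jm c\<close> are distinct because
      \<open>c\<close> is positive definite.\<close>
    case False
    then have "y = (\<lambda>_. 0)" if "y \<in> Rvec D" for y using that by blast
    then have "Rvec D \<subseteq> {c}" using c(1) by (metis singletonI subsetI)
    then have "K = {c}" using cK by (auto simp: K_def)
    then have "h x = c" if "x \<in> cls m ` V m" for x using hs that by (metis imageI singletonD)
    then have "h (jp c) = h (jm c)" using jpV[OF cK] jmV[OF cK] by simp
    then have "jp c = jm c" using h_eq jpV[OF cK] jmV[OF cK] by blast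
    then show False using jp_jm[OF cK cK] c by blast
  qed
qed

end

theorem theorem5p3:
  fixes n d :: nat and l :: "nat \<Rightarrow> real"
  assumes "n \<ge> 3" and "l \<in> intC n" and "d \<ge> 2"
  shows "(polyM n l d homeomorphic_space polyM n l n) \<longleftrightarrow> d \<ge> n"
proof -
  interpret polygon_space n l
    using assms by unfold_locales
  have K: "polyM n l n homeomorphic_space top_of_set K"
    by (rule polyM_homeomorphic_K) simp
  show ?thesis
  proof
    assume "n \<le> d"
    then show "polyM n l d homeomorphic_space polyM n l n"
      using polyM_homeomorphic_K K homeomorphic_space_sym homeomorphic_space_trans by blast
  next
    assume "polyM n l d homeomorphic_space polyM n l n"
    then have dK: "polyM n l d homeomorphic_space top_of_set K"
      using K homeomorphic_space_trans by blast
    then have "\<not> d < m"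
      using not_homeomorphic_low homeomorphic_space_sym by blast
    moreover have "d \<noteq> m"
      using dK not_homeomorphic_double by blast
    ultimately show "n \<le> d"
      using n_Suc by linarith
  qed
qed

end
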